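(* For odd $n\ge 3$, the graph $\mathcal{H}_n$ has minimum degree $2$, and there are exactly $n\cdot (C_{(n-3)/2})^2$ vertices of degree $2$, namely the matchings that contain one edge of length $\mu$ passing through the circle center and two edges of length $\mu-1$. For even $n\ge 2$, the graph $\mathcal{H}_n$ has minimum degree $1$, and there are exactly $n\cdot (C_{(n-2)/2})^2$ vertices of degree $1$, namely the matchings that contain exactly two edges of length $\mu$.
   Context: Fix an integer $n\ge 2$ and place $2n$ points equidistantly on the unit circle. $\mathcal{M}_n$ is the set of all non-crossing straight-line perfect matchings on these $2n$ points (each has $n$ edges). For $M\in\mathcal{M}_n$, two edges $e,f\in M$ span an empty quadrilateral if the convex hull of $e$ and $f$ contains no other edge of $M$; replacing $e,f$ by the other two edges of this quadrilateral yields another matching of $\mathcal{M}_n$ (a flip). A flip is centered if the closed quadrilateral contains the center of the circle (possibly on its boundary). $\mathcal{H}_n$ is the graph with vertex set $\mathcal{M}_n$ and an edge between two matchings if they differ by a centered flip. For $e\in M$, the length $\ell(e)$ is the minimum, over the two sides of the line through $e$, of the number of other edges of $M$ lying on that side. $\mu:=\lceil (n-2)/2\rceil$ is the maximum possible edge length. $C_k=\frac{1}{k+1}\binom{2k}{k}$ is the $k$th Catalan number. *)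

theory Defs
  imports "HOL-Analysis.Analysis"
begin

text \<open>The points are labelled \<open>0, \<dots>, 2 * n - 1\<close> in counterclockwise order. An edge is a set of two
  labels; \<open>pt_hull n {i, j}\<close> is the straight-line segment it stands for.\<close>

definition pt :: "nat \<Rightarrow> nat \<Rightarrow> complex" where
  "pt n k = cis (2 * pi * real k / real (2 * n))"

definition pt_hull :: "nat \<Rightarrow> nat set \<Rightarrow> complex set" where
  "pt_hull n A = convex hull (pt n ` A)"

definition perfect_matching :: "nat \<Rightarrow> nat set set \<Rightarrow> bool" where
  "perfect_matching n M \<longleftrightarrow>
     (\<forall>e\<in>M. e \<subseteq> {..<2 * n} \<and> card e = 2) \<and> (\<forall>k<2 * n. \<exists>!e. e \<in> M \<and> k \<in> e)"

definition noncrossing :: "nat \<Rightarrow> nat set set \<Rightarrow> bool" where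
  "noncrossing n M \<longleftrightarrow> (\<forall>e\<in>M. \<forall>f\<in>M. e \<noteq> f \<longrightarrow> pt_hull n e \<inter> pt_hull n f = {})"

definition matchings :: "nat \<Rightarrow> nat set set set" where
  "matchings n = {M. perfect_matching n M \<and> noncrossing n M}"

text \<open>No other edge has both endpoints in the quadrilateral, as its only marked points are its four
  corners; hence emptiness has to mean that no other edge of the matching meets (that is, runs
  through) the quadrilateral.\<close>

definition empty_quadrilateral :: "nat \<Rightarrow> nat set set \<Rightarrow> nat set \<Rightarrow> nat set \<Rightarrow> bool" where
  "empty_quadrilateral n M e f \<longleftrightarrow>
     e \<in> M \<and> f \<in> M \<and> e \<noteq> f \<and> (\<forall>g\<in>M - {e, f}. pt_hull n g \<inter> pt_hull n (e \<union> f) = {})"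

definition quadrilateral_edges :: "nat \<Rightarrow> nat set \<Rightarrow> nat set \<Rightarrow> nat set set" where
  "quadrilateral_edges n e f =
     {g. g \<subseteq> e \<union> f \<and> card g = 2 \<and> pt_hull n g edge_of pt_hull n (e \<union> f)}"

definition flip :: "nat \<Rightarrow> nat set set \<Rightarrow> nat set \<Rightarrow> nat set \<Rightarrow> nat set set" where
  "flip n M e f = (M - {e, f}) \<union> (quadrilateral_edges n e f - {e, f})"

definition centered_flip :: "nat \<Rightarrow> nat set set \<Rightarrow> nat set set \<Rightarrow> bool" where
  "centered_flip n M N \<longleftrightarrow>
     (\<exists>e f. empty_quadrilateral n M e f \<and> 0 \<in> pt_hull n (e \<union> f) \<and> N = flip n M e f)"

definition H_edges :: "nat \<Rightarrow> nat set set set set" where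
  "H_edges n = {{M, N} | M N. M \<in> matchings n \<and> N \<in> matchings n \<and> centered_flip n M N}"

definition H_degree :: "nat \<Rightarrow> nat set set \<Rightarrow> nat" where
  "H_degree n M = card {E \<in> H_edges n. M \<in> E}"

definition H_min_degree :: "nat \<Rightarrow> nat" where
  "H_min_degree n = Min (H_degree n ` matchings n)"

text \<open>The open half-plane to the left of the line directed from \<open>a\<close> to \<open>b\<close>; \<open>left_side b a\<close> is the
  other side of that line.\<close>

definition left_side :: "complex \<Rightarrow> complex \<Rightarrow> complex set" where
  "left_side a b = {z. 0 < Im (cnj (b - a) * (z - a))}"

definition edge_length :: "nat \<Rightarrow> nat set set \<Rightarrow> nat set \<Rightarrow> nat" where
  "edge_length n M e =
     (let a = pt n (Min e); b = pt n (Max e)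
      in min (card {f \<in> M - {e}. pt_hull n f \<subseteq> left_side a b})
             (card {f \<in> M - {e}. pt_hull n f \<subseteq> left_side b a}))"

definition mu :: "nat \<Rightarrow> nat" where
  "mu n = nat \<lceil>(real n - 2) / 2\<rceil>"

definition catalan :: "nat \<Rightarrow> real" where
  "catalan k = 1 / (real k + 1) * real ((2 * k) choose k)"

end

theory Submission
  imports Defs
begin

text \<open>A pair of edges of \<open>M\<close> spans an empty quadrilateral containing the center only if neither edge is
  cut off from the center by another edge, that is, if both are outer. If no edge is a diameter, the
  closed caps cut off by the outer edges partition the \<open>2 * n\<close> labels, and two outer edges admit a
  centered flip as soon as their caps contain a pair of antipodal labels. Every outer edge is therefore
  in a centered flip. A single flip forces two caps of \<open>n\<close> labels each, which needs \<open>n\<close> even. At most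
  two flips form a bipartite graph on the outer edges, and a colour class would cover exactly \<open>n\<close>
  labels; as caps have even size, this is impossible for odd \<open>n\<close>. If \<open>M\<close> contains a diameter, which
  needs \<open>n\<close> odd, the centered flips are those of the diameter with the other outer edges, and there is
  at least one of these on each side. The extremal matchings are determined by two or three fixed edges
  that leave two gaps to be filled independently, which gives the squared Catalan numbers.\<close>

section \<open>Chords between equidistant points\<close>

text \<open>The definitions speak of hulls, faces, half-planes and the center, while the argument is
  about labels. The bridge is the sign of a triangle's area, taken for three points or for two
  points and the center: it turns every geometric condition into inequalities between labels. The
  circle has to be cut at label 0 for this, so a cap is either an interval or the complement of one;
  most case distinctions have this origin. Antipodal labels \<open>x\<close> and
  \<open>x + n\<close> in the disjoint caps of two outer edges force a centered flip because each of
  the two arcs joining the caps fits into one of the half circles between \<open>x\<close> and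
  \<open>x + n\<close>, and each cap spans fewer than \<open>n\<close> steps. All four arcs between
  consecutive corners then have at most \<open>n\<close> steps, which puts the center into the
  quadrilateral. A union of caps has an even number of labels because an edge with one endpoint in a
  cap has both there. The number three in the odd case is the length of a shortest odd cycle: with
  fewer pairs, a two-colouring of the outer edges exists.\<close>

lemma left_side_eq_halfspace:
  "left_side a b = {z. (\<i> * (b - a)) \<bullet> z > (\<i> * (b - a)) \<bullet> a}"
  by (auto simp: left_side_def inner_complex_def algebra_simps)

lemma convex_left_side: "convex (left_side a b)"
  unfolding left_side_eq_halfspace by (rule convex_halfspace_gt)

lemma convex_Compl_left_side: "convex (- left_side a b)"
proof -
  have "- left_side a b = {z. (\<i> * (b - a)) \<bullet> z \<le> (\<i> * (b - a)) \<bullet> a}"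
    unfolding left_side_eq_halfspace by auto
  then show ?thesis by (simp add: convex_halfspace_le)
qed

text \<open>On the line through \<open>a\<close> and \<open>b\<close>, the displacement from either
  point is a real multiple of the direction, so the imaginary part that defines the two sides
  vanishes.\<close>

lemma affine_hull_disjoint_left_side:
  assumes "z \<in> affine hull {a, b}"
  shows "z \<notin> left_side a b" "z \<notin> left_side b a"
proof -
  obtain u v where z: "z = u *\<^sub>R a + v *\<^sub>R b" and "u + v = 1"
    using assms unfolding affine_hull_2 by blast
  then have "z - a = v *\<^sub>R (b - a)" "z - b = u *\<^sub>R (a - b)"
    by (simp_all add: algebra_simps flip: scaleR_left.add)
  moreover have "Im (cnj w * (r *\<^sub>R w)) = 0" for w and r :: real
    by (simp add: algebra_simps)
  ultimately show "z \<notin> left_side a b" "z \<notin> left_side b a"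
    unfolding left_side_def mem_Collect_eq by (metis less_irrefl)+
qed

text \<open>The left-hand side is twice the signed area of the triangle. The angles are written
  doubled so that the factors are sines of differences of half angles, whose signs can be read
  off.\<close>

lemma orientation_of_cis:
  "Im (cnj (cis (2 * B) - cis (2 * A)) * (cis (2 * C) - cis (2 * A))) =
     4 * sin (B - A) * sin (C - B) * sin (C - A)"
proof -
  define p q where "p = B - A" and "q = C - B"
  have B: "B = A + p" and C: "C = A + (p + q)" by (simp_all add: p_def q_def)
  have "Im (cnj (cis (2 * B) - cis (2 * A)) * (cis (2 * C) - cis (2 * A))) =
      sin (2 * C - 2 * B) - sin (2 * C - 2 * A) + sin (2 * B - 2 * A)"
    by (simp add: sin_diff algebra_simps)
  also have "\<dots> = sin (2 * q) + sin (2 * p) - sin (2 * p + 2 * q)"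
    by (simp add: B C algebra_simps)
  also have "\<dots> = sin (2 * q) * (1 - cos (2 * p)) + sin (2 * p) * (1 - cos (2 * q))"
    by (simp add: sin_add algebra_simps)
  also have "\<dots> = 4 * sin p * sin q * sin (p + q)"
    unfolding sin_double cos_double_sin sin_add by (simp add: power2_eq_square algebra_simps)
  finally show ?thesis by (simp add: p_def q_def)
qed

text \<open>Half angles of labels lie in a half-open interval of length \<open>pi\<close>, so their
  differences stay strictly between \<open>- pi\<close> and \<open>pi\<close>, where the sine has
  the sign of its argument.\<close>

lemma sgn_sin_label_diff:
  assumes "i < 2 * n" "j < 2 * n"
  shows "sgn (sin (pi * real j / real (2 * n) - pi * real i / real (2 * n))) = sgn (real j - real i)"
proof -
  have pos: "sin (pi * real l / real (2 * n) - pi * real k / real (2 * n)) > 0"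
    if "k < l" "l < 2 * n" for k l
  proof (rule sin_gt_zero)
    show "0 < pi * real l / real (2 * n) - pi * real k / real (2 * n)"
      using that by (simp add: divide_strict_right_mono)
    have "real l - real k < real (2 * n)" using that by linarith
    then have "pi * (real l - real k) < pi * real (2 * n)"
      by (intro mult_strict_left_mono) auto
    then have "pi * (real l - real k) / real (2 * n) < pi"
      using that by (simp add: divide_less_eq)
    then show "pi * real l / real (2 * n) - pi * real k / real (2 * n) < pi"
      by (simp add: diff_divide_distrib right_diff_distrib)
  qed
  consider "i < j" | "i = j" | "j < i" by linarith
  then show ?thesis
  proof cases
    case 3
    have "sin (pi * real j / real (2 * n) - pi * real i / real (2 * n))
        = - sin (pi * real i / real (2 * n) - pi * real j / real (2 * n))"
      using sin_minus[of "pi * real i / real (2 * n) - pi * real j / real (2 * n)"] by simp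
    then show ?thesis using pos[of j i] 3 assms by simp
  qed (use pos assms in auto)
qed

lemma pt_eq: "pt n k = cis (2 * (pi * real k / real (2 * n)))"
  by (simp add: pt_def field_simps)

text \<open>For distinct labels the right-hand side is the sign of the permutation that sorts them;
  it is 0 as soon as two of them coincide.\<close>

lemma sgn_orientation_pt:
  assumes "i < 2 * n" "j < 2 * n" "k < 2 * n"
  shows "sgn (Im (cnj (pt n j - pt n i) * (pt n k - pt n i))) =
    sgn (real j - real i) * sgn (real k - real j) * sgn (real k - real i)"
  unfolding pt_eq orientation_of_cis using assms by (simp add: sgn_mult sgn_sin_label_diff del: of_nat_mult)

lemma pt_in_left_side:
  assumes "i < j" "j < 2 * n" "k < 2 * n"
  shows "pt n k \<in> left_side (pt n i) (pt n j) \<longleftrightarrow> k < i \<or> j < k"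
    and "pt n k \<in> left_side (pt n j) (pt n i) \<longleftrightarrow> i < k \<and> k < j"
proof -
  have *: "0 < r \<longleftrightarrow> sgn r = 1" for r :: real by (simp add: sgn_if)
  show "pt n k \<in> left_side (pt n i) (pt n j) \<longleftrightarrow> k < i \<or> j < k"
    and "pt n k \<in> left_side (pt n j) (pt n i) \<longleftrightarrow> i < k \<and> k < j"
    unfolding left_side_def mem_Collect_eq *
      sgn_orientation_pt[OF less_trans[OF assms(1,2)] assms(2,3)]
      sgn_orientation_pt[OF assms(2) less_trans[OF assms(1,2)] assms(3)]
    using assms by (auto simp: sgn_if)
qed

lemma inj_on_pt: "inj_on (pt n) {..<2 * n}"
proof -
  have "pt n i \<noteq> pt n j" if "i < j" "j < 2 * n" for i j
  proof
    define t where "t = pi * real j / real (2 * n) - pi * real i / real (2 * n)"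
    assume "pt n i = pt n j"
    then have "cnj (pt n i) * pt n j = 1"
      by (simp add: pt_def cis_cnj cis_mult)
    moreover have "cnj (pt n i) * pt n j = cis (2 * t)"
      unfolding pt_eq cis_cnj cis_mult t_def by (simp add: algebra_simps)
    ultimately have "cos (2 * t) = 1" by (metis cis.simps(1) one_complex.simps(1))
    then have "sin t = 0" by (simp add: cos_double_sin)
    then show False using sgn_sin_label_diff[of i n j] that by (simp add: t_def)
  qed
  then show ?thesis by (intro linorder_inj_onI) auto
qed

section \<open>The center relative to a chord\<close>

lemma Im_cnj_pt_mult_pt:
  "Im (cnj (pt n i) * pt n j) = sin (pi * (real j - real i) / real n)"
proof -
  have "Im (cnj (pt n i) * pt n j) = Im (cis (pi * (real j - real i) / real n))"
    by (simp add: pt_def cis_cnj cis_mult field_simps diff_divide_distrib)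
  then show ?thesis by simp
qed

text \<open>This is the orientation of the triangle formed by the center and two points. The sine of
  the central angle changes sign at the half turn, that is, at a difference of \<open>n\<close>
  steps.\<close>

lemma sgn_Im_cnj_pt_mult_pt:
  assumes "i < j" "j < 2 * n"
  shows "sgn (Im (cnj (pt n i) * pt n j)) = sgn (real n - (real j - real i))"
proof -
  define t where "t = (real j - real i) / real n"
  have t: "0 < t" "t < 2" using assms by (auto simp: t_def field_simps)
  have n: "real n > 0" using assms by linarith
  have "sgn (sin (pi * t)) = sgn (1 - t)"
  proof -
    consider "t < 1" | "t = 1" | "1 < t" by linarith
    then show ?thesis
    proof cases
      case 1
      then have "sin (pi * t) > 0" using t by (intro sin_gt_zero) auto
      then show ?thesis using 1 by simp
    next
      case 3
      have "sin (pi * (t - 1)) > 0" using t 3 by (intro sin_gt_zero) auto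
      then have "sin (pi * t) < 0" by (simp add: right_diff_distrib sin_diff)
      then show ?thesis using 3 by simp
    qed simp
  qed
  also have "sgn (1 - t) = sgn (real n - (real j - real i))"
    using n by (auto simp: t_def sgn_if field_simps)
  finally show ?thesis unfolding Im_cnj_pt_mult_pt by (simp add: t_def)
qed

lemma zero_in_left_side:
  assumes "i < j" "j < 2 * n"
  shows "0 \<in> left_side (pt n i) (pt n j) \<longleftrightarrow> j - i < n"
    and "0 \<in> left_side (pt n j) (pt n i) \<longleftrightarrow> n < j - i"
proof -
  have "Im (cnj (pt n j - pt n i) * (0 - pt n i)) = Im (cnj (pt n i) * pt n j)"
     "Im (cnj (pt n i - pt n j) * (0 - pt n j)) = - Im (cnj (pt n i) * pt n j)"
    by (simp_all add: algebra_simps)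
  then show "0 \<in> left_side (pt n i) (pt n j) \<longleftrightarrow> j - i < n"
    and "0 \<in> left_side (pt n j) (pt n i) \<longleftrightarrow> n < j - i"
    using sgn_Im_cnj_pt_mult_pt[OF assms] assms
    unfolding left_side_def mem_Collect_eq by (auto simp: sgn_if split: if_splits)
qed

section \<open>Chords and hulls of label sets\<close>

lemma pt_hull_subset_iff:
  assumes "convex C"
  shows "pt_hull n S \<subseteq> C \<longleftrightarrow> (\<forall>x\<in>S. pt n x \<in> C)"
  unfolding pt_hull_def using assms by (auto simp: subset_hull)

lemma pt_hull_mono: "S \<subseteq> T \<Longrightarrow> pt_hull n S \<subseteq> pt_hull n T"
  unfolding pt_hull_def by (intro hull_mono image_mono)

text \<open>The common point is the Radon point of the four points: its barycentric coordinates are the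
  areas of the triangles spanned by the other three points.\<close>

lemma crossing_chords_meet:
  assumes "i < k" "k < j" "j < l" "l < 2 * n"
  shows "pt_hull n {i, j} \<inter> pt_hull n {k, l} \<noteq> {}"
proof -
  define area where "area x y z = Im (cnj (y - x) * (z - x))" for x y z :: complex
  define a b c d where "a = pt n i" and "b = pt n k" and "c = pt n j" and "d = pt n l"
  have pos: "0 < area (pt n x) (pt n y) (pt n z)" if "x < y" "y < z" "z < 2 * n" for x y z
    using pt_in_left_side(1)[of x y n z] that by (simp add: left_side_def area_def)
  define s where "s = area b c d + area a b d"
  have p: "0 < area b c d" "0 < area a b d" "0 < area a c d" "0 < area a b c"
    using pos assms by (simp_all add: a_def b_def c_def d_def)
  have s: "s > 0" "s = area a c d + area a b c"
    using p by (simp_all add: s_def) (simp add: area_def algebra_simps)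
  have eq: "area b c d *\<^sub>R a + area a b d *\<^sub>R c = area a c d *\<^sub>R b + area a b c *\<^sub>R d"
    by (simp add: complex_eq_iff area_def algebra_simps)
  define x where "x = (area b c d / s) *\<^sub>R a + (area a b d / s) *\<^sub>R c"
  have x2: "x = (area a c d / s) *\<^sub>R b + (area a b c / s) *\<^sub>R d"
    using arg_cong[OF eq, of "\<lambda>z. (1 / s) *\<^sub>R z"] by (simp add: x_def scaleR_add_right)
  have "x \<in> convex hull {a, c}"
    unfolding convex_hull_2 x_def using p s s_def
    by (force simp flip: add_divide_distrib)
  moreover have "x \<in> convex hull {b, d}"
    unfolding convex_hull_2 x2 using p s
    by (force simp flip: add_divide_distrib)
  ultimately show ?thesis by (auto simp: pt_hull_def a_def b_def c_def d_def)
qed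

text \<open>All points of \<open>S\<close> lie in one open half-plane bounded by the line. The whole
  line is avoided, not only the chord, because the criterion for faces of convex hulls,
  \<open>face_of_convex_hulls\<close>, asks for the affine hull.\<close>

lemma affine_hull_disjoint_pt_hull:
  assumes "k < l" "l < 2 * n" "S \<subseteq> {..<2 * n}" "k \<notin> S" "l \<notin> S"
    and "S \<subseteq> {k<..<l} \<or> S \<inter> {k<..<l} = {}"
  shows "affine hull {pt n k, pt n l} \<inter> pt_hull n S = {}"
  using assms(6)
proof
  assume "S \<subseteq> {k<..<l}"
  then have "pt_hull n S \<subseteq> left_side (pt n l) (pt n k)"
    unfolding pt_hull_subset_iff[OF convex_left_side] using assms(1-3)
    by (auto simp: pt_in_left_side subset_eq)
  then show ?thesis using affine_hull_disjoint_left_side by blast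
next
  assume S: "S \<inter> {k<..<l} = {}"
  have "x < k \<or> l < x" if "x \<in> S" for x
  proof -
    have "x \<noteq> k" "x \<noteq> l" "\<not> (k < x \<and> x < l)" using that S assms by auto
    then show ?thesis by linarith
  qed
  then have "pt_hull n S \<subseteq> left_side (pt n k) (pt n l)"
    unfolding pt_hull_subset_iff[OF convex_left_side] using assms(1-3)
    by (auto simp: pt_in_left_side subset_eq)
  then show ?thesis using affine_hull_disjoint_left_side by blast
qed

text \<open>If \<open>S\<close> had labels on both sides of the chord, two of them would span a
  crossing chord inside the hull of \<open>S\<close>.\<close>

lemma pt_hull_disjoint_iff:
  assumes "k < l" "l < 2 * n" "S \<subseteq> {..<2 * n}" "k \<notin> S" "l \<notin> S"
  shows "pt_hull n {k, l} \<inter> pt_hull n S = {} \<longleftrightarrow> S \<subseteq> {k<..<l} \<or> S \<inter> {k<..<l} = {}"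
proof
  assume disj: "pt_hull n {k, l} \<inter> pt_hull n S = {}"
  show "S \<subseteq> {k<..<l} \<or> S \<inter> {k<..<l} = {}"
  proof (rule ccontr)
    assume "\<not> ?thesis"
    then obtain x y where xy: "x \<in> S" "y \<in> S" "k < x" "x < l" "\<not> (k < y \<and> y < l)"
      unfolding subset_eq greaterThanLessThan_iff disjoint_iff by blast
    have "y < 2 * n" "y \<noteq> k" "y \<noteq> l" using xy assms by auto
    then have "y < k \<or> l < y" using xy by linarith
    then have "pt_hull n {k, l} \<inter> pt_hull n {x, y} \<noteq> {}"
      using crossing_chords_meet[of y k x l n] crossing_chords_meet[of k x l y n] xy assms
        \<open>y < 2 * n\<close> by (auto simp: insert_commute Int_commute)
    moreover have "pt_hull n {x, y} \<subseteq> pt_hull n S" using xy by (intro pt_hull_mono) auto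
    ultimately show False using disj by blast
  qed
next
  assume "S \<subseteq> {k<..<l} \<or> S \<inter> {k<..<l} = {}"
  then show "pt_hull n {k, l} \<inter> pt_hull n S = {}"
    using affine_hull_disjoint_pt_hull[OF assms] convex_hull_subset_affine_hull[of "{pt n k, pt n l}"]
    by (auto simp: pt_hull_def)
qed

text \<open>A chord with corners \<open>x\<close> and \<open>y\<close> on different sides is crossed
  by the chord from \<open>x\<close> to \<open>y\<close>. The crossing point is interior to that
  segment, so a face containing it would have to contain \<open>x\<close> and \<open>y\<close> as
  well, and neither lies on the chord.\<close>

lemma pt_hull_edge_of_iff:
  assumes "k < l" "l < 2 * n" "S \<subseteq> {..<2 * n}" "k \<in> S" "l \<in> S"
  shows "pt_hull n {k, l} edge_of pt_hull n S \<longleftrightarrow>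
    S - {k, l} \<subseteq> {k<..<l} \<or> S \<inter> {k<..<l} = {}"
proof
  assume "S - {k, l} \<subseteq> {k<..<l} \<or> S \<inter> {k<..<l} = {}"
  then have "affine hull {pt n k, pt n l} \<inter> pt_hull n (S - {k, l}) = {}"
    using assms by (intro affine_hull_disjoint_pt_hull) auto
  moreover have inj: "inj_on (pt n) S"
    using inj_on_pt assms inj_on_subset by blast
  then have "pt n ` S - {pt n k, pt n l} = pt n ` (S - {k, l})"
    using assms inj_on_image_set_diff[of "pt n" S S "{k, l}"] by auto
  ultimately have "pt_hull n {k, l} face_of pt_hull n S"
    unfolding pt_hull_def using assms finite_subset[OF assms(3)]
    by (intro face_of_convex_hulls) auto
  moreover have "pt n k \<noteq> pt n l" using inj assms by (auto dest: inj_onD)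
  ultimately show "pt_hull n {k, l} edge_of pt_hull n S"
    by (simp add: edge_of_def pt_hull_def aff_dim_convex_hull)
next
  assume edge: "pt_hull n {k, l} edge_of pt_hull n S"
  show "S - {k, l} \<subseteq> {k<..<l} \<or> S \<inter> {k<..<l} = {}"
  proof (rule ccontr)
    assume "\<not> ?thesis"
    then obtain x y where xy: "x \<in> S" "y \<in> S" "k < x" "x < l" "y \<noteq> k" "y \<noteq> l" "\<not> (k < y \<and> y < l)"
      unfolding subset_eq greaterThanLessThan_iff disjoint_iff by blast
    have off: "pt n z \<notin> pt_hull n {k, l}" if "z \<in> S" "z \<noteq> k" "z \<noteq> l" for z
    proof -
      have "pt_hull n {k, l} \<inter> pt_hull n {z} = {}"
        using assms that by (subst pt_hull_disjoint_iff) auto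
      then show ?thesis by (simp add: pt_hull_def)
    qed
    have "pt_hull n {k, l} \<inter> pt_hull n {x, y} \<noteq> {}"
      using xy assms by (subst pt_hull_disjoint_iff) auto
    then obtain z where z: "z \<in> pt_hull n {k, l}" "z \<in> closed_segment (pt n x) (pt n y)"
      by (auto simp: pt_hull_def segment_convex_hull)
    have nx: "pt n x \<notin> pt_hull n {k, l}" "pt n y \<notin> pt_hull n {k, l}" using off xy by auto
    then have "z \<in> open_segment (pt n x) (pt n y)"
      using z by (auto simp: open_segment_def)
    moreover have "pt n x \<in> pt_hull n S" "pt n y \<in> pt_hull n S"
      using xy by (auto simp: pt_hull_def intro: hull_inc)
    ultimately show False
      using edge z(1) nx unfolding edge_of_def face_of_def by blast
  qed
qed

section \<open>Position of the center relative to a hull\<close>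

lemma zero_notin_pt_hull:
  assumes "i < j" "j < 2 * n" "S \<subseteq> {..<2 * n}"
    and "j - i < n \<and> S \<subseteq> {i..j} \<or> n < j - i \<and> S \<inter> {i<..<j} = {}"
  shows "0 \<notin> pt_hull n S"
proof
  assume 0: "0 \<in> pt_hull n S"
  from assms(4) show False
  proof (elim disjE conjE)
    assume "j - i < n" "S \<subseteq> {i..j}"
    \<comment> \<open>The complement of an open half-plane is convex, so the hull stays on the
      closed side of the chord while the center lies strictly on the other one.\<close>
    then have "pt_hull n S \<subseteq> - left_side (pt n i) (pt n j)"
      unfolding pt_hull_subset_iff[OF convex_Compl_left_side] using assms(1-3)
      by (fastforce simp: pt_in_left_side)
    then show False
      using 0 \<open>j - i < n\<close> assms by (auto simp: zero_in_left_side)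
  next
    assume "n < j - i" "S \<inter> {i<..<j} = {}"
    then have "pt_hull n S \<subseteq> - left_side (pt n j) (pt n i)"
      unfolding pt_hull_subset_iff[OF convex_Compl_left_side] using assms(1-3)
      by (fastforce simp: pt_in_left_side)
    then show False
      using 0 \<open>n < j - i\<close> assms by (auto simp: zero_in_left_side)
  qed
qed

text \<open>The barycentric coordinates of the center are the signed areas of the triangles it spans
  with the three sides. They are nonnegative because each of the three arcs, the last one passing
  label 0, has at most \<open>n\<close> steps.\<close>

lemma zero_in_pt_hull_triangle:
  assumes "i < j" "j < k" "k < 2 * n" "j - i \<le> n" "k - j \<le> n" "n \<le> k - i"
  shows "0 \<in> pt_hull n {i, j, k}"
proof -
  define ar where "ar x y = Im (cnj (pt n x) * pt n y)" for x y
  have nonneg: "0 \<le> ar i j" "0 \<le> ar j k" "ar i k \<le> 0"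
    using sgn_Im_cnj_pt_mult_pt[of i j n] sgn_Im_cnj_pt_mult_pt[of j k n]
      sgn_Im_cnj_pt_mult_pt[of i k n] assms
    unfolding ar_def by (auto simp: sgn_if split: if_splits)
  define s where "s = ar i j + ar j k - ar i k"
  have "s = Im (cnj (pt n j - pt n i) * (pt n k - pt n i))"
    by (simp add: s_def ar_def algebra_simps)
  then have s: "s > 0"
    using pt_in_left_side(1)[of i j n k] assms by (simp add: left_side_def)
  have eq: "ar j k *\<^sub>R pt n i + (- ar i k) *\<^sub>R pt n j + ar i j *\<^sub>R pt n k = 0"
    by (simp add: complex_eq_iff ar_def algebra_simps)
  have "0 = (ar j k / s) *\<^sub>R pt n i + (- ar i k / s) *\<^sub>R pt n j + (ar i j / s) *\<^sub>R pt n k"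
    using arg_cong[OF eq, of "\<lambda>z. (1 / s) *\<^sub>R z"] by (simp add: scaleR_add_right scaleR_diff_right)
  moreover have "ar j k / s + - ar i k / s + ar i j / s = 1"
    using s by (simp add: s_def flip: add_divide_distrib diff_divide_distrib)
  moreover have "0 \<le> ar j k / s" "0 \<le> - ar i k / s" "0 \<le> ar i j / s"
    using nonneg s by (auto simp: divide_nonpos_pos)
  ultimately show ?thesis unfolding pt_hull_def image_insert image_empty convex_hull_3 by blast
qed

text \<open>The diagonal from \<open>a\<close> to \<open>c\<close> cuts the quadrilateral into two
  triangles; the arc from \<open>a\<close> to \<open>c\<close> tells which of them contains the
  center.\<close>

lemma zero_in_pt_hull_quadrilateral:
  assumes "a < b" "b < c" "c < d" "d < 2 * n" "b - a \<le> n" "c - b \<le> n" "d - c \<le> n" "n \<le> d - a"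
  shows "0 \<in> pt_hull n {a, b, c, d}"
proof (cases "n \<le> c - a")
  case True
  then have "0 \<in> pt_hull n {a, b, c}" using assms by (intro zero_in_pt_hull_triangle) auto
  then show ?thesis using pt_hull_mono[of "{a, b, c}" "{a, b, c, d}" n] by auto
next
  case False
  then have "0 \<in> pt_hull n {a, c, d}" using assms by (intro zero_in_pt_hull_triangle) auto
  then show ?thesis using pt_hull_mono[of "{a, c, d}" "{a, b, c, d}" n] by auto
qed

lemma zero_in_pt_hull_chord_iff:
  assumes "i < j" "j < 2 * n"
  shows "0 \<in> pt_hull n {i, j} \<longleftrightarrow> j - i = n"
proof
  assume "0 \<in> pt_hull n {i, j}"
  then show "j - i = n"
    using zero_notin_pt_hull[of i j n "{i, j}"] assms by (cases "j - i" n rule: linorder_cases) auto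
next
  assume "j - i = n"
  then have "real j = real i + real n" "n > 0" using assms by auto
  then have "2 * pi * real j / real (2 * n) = 2 * pi * real i / real (2 * n) + pi"
    by (simp add: field_simps)
  then have "pt n j = cis (2 * pi * real i / real (2 * n) + pi)"
    unfolding pt_def by simp
  then have "pt n j = - pt n i"
    by (simp add: pt_def flip: cis_mult)
  then have "0 = (1/2) *\<^sub>R pt n i + (1/2) *\<^sub>R pt n j" by simp
  then show "0 \<in> pt_hull n {i, j}"
    unfolding pt_hull_def image_insert image_empty convex_hull_2 by force
qed

section \<open>Counting non-crossing matchings\<close>

definition between :: "nat set \<Rightarrow> nat set" where
  "between e = {Min e<..<Max e}"

definition matching_on :: "nat set \<Rightarrow> nat set set \<Rightarrow> bool" where
  "matching_on S M \<longleftrightarrow> (\<forall>e\<in>M. e \<subseteq> S \<and> card e = 2) \<and> (\<forall>k\<in>S. \<exists>!e. e \<in> M \<and> k \<in> e)"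

text \<open>The ground set is arbitrary, since the labels outside a chord form an interval with a
  gap. Both sides of an edge thus carry objects of the same kind, which is what the recursion for
  the count needs.\<close>

definition ncm :: "nat set \<Rightarrow> nat set set set" where
  "ncm S = {M. matching_on S M \<and>
     (\<forall>e\<in>M. \<forall>f\<in>M. e \<noteq> f \<longrightarrow> f \<subseteq> between e \<or> f \<inter> between e = {})}"

lemma between_insert: "i < j \<Longrightarrow> between {i, j} = {i<..<j}"
  by (simp add: between_def)

lemma card_2_ordered:
  assumes "card e = 2"
  obtains i j :: nat where "i < j" "e = {i, j}"
  using assms unfolding card_2_iff by (metis insert_commute linorder_neqE_nat)

lemma matching_onD:
  assumes "matching_on S M"
  shows "e \<in> M \<Longrightarrow> e \<subseteq> S" "e \<in> M \<Longrightarrow> card e = 2"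
    "e \<in> M \<Longrightarrow> f \<in> M \<Longrightarrow> x \<in> e \<Longrightarrow> x \<in> f \<Longrightarrow> e = f"
  using assms unfolding matching_on_def by blast+

lemma matching_on_edge:
  assumes "matching_on S M" "e \<in> M"
  obtains i j where "i < j" "e = {i, j}" "i \<in> S" "j \<in> S"
proof -
  obtain i j where "i < j" "e = {i, j}" using card_2_ordered matching_onD(2)[OF assms] by metis
  then show ?thesis using that matching_onD(1)[OF assms] by blast
qed

lemma matching_on_cover:
  assumes "matching_on S M" "x \<in> S"
  obtains e where "e \<in> M" "x \<in> e"
  using assms unfolding matching_on_def by blast

lemma matching_onI:
  assumes "\<And>e. e \<in> M \<Longrightarrow> e \<subseteq> S \<and> card e = 2"
    and "\<And>x. x \<in> S \<Longrightarrow> \<exists>e\<in>M. x \<in> e"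
    and "\<And>e f x. e \<in> M \<Longrightarrow> f \<in> M \<Longrightarrow> x \<in> e \<Longrightarrow> x \<in> f \<Longrightarrow> e = f"
  shows "matching_on S M"
  unfolding matching_on_def using assms by metis

lemma matching_on_finite: "matching_on S M \<Longrightarrow> finite S \<Longrightarrow> finite M"
  by (rule finite_subset[of _ "Pow S"]) (auto dest: matching_onD(1))

text \<open>Together with \<open>card_matching_on\<close> this is the source of the parity
  arguments: a set of labels that no edge leaves is matched within itself, hence has even size if it
  is finite.\<close>

lemma matching_on_subset:
  assumes M: "matching_on S M" and T: "T \<subseteq> S" "\<And>e. e \<in> M \<Longrightarrow> e \<inter> T \<noteq> {} \<Longrightarrow> e \<subseteq> T"
  shows "matching_on T {e \<in> M. e \<subseteq> T}"
proof (rule matching_onI)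
  fix x assume x: "x \<in> T"
  then obtain e where "e \<in> M" "x \<in> e" using matching_on_cover[OF M] T(1) by blast
  then show "\<exists>e\<in>{e \<in> M. e \<subseteq> T}. x \<in> e" using T(2)[of e] x by auto
qed (use matching_onD[OF M] in auto)

lemma card_matching_on:
  assumes M: "matching_on S M" and "finite S"
  shows "card S = 2 * card M"
proof -
  have "\<Union>M = S" using matching_onD(1)[OF M] matching_on_cover[OF M] by blast
  moreover have "card (\<Union>M) = sum card M"
  proof (rule card_Union_disjoint)
    show "pairwise disjnt M"
      unfolding pairwise_def disjnt_iff using matching_onD(3)[OF M] by blast
    show "finite A" if "A \<in> M" for A
      using matching_onD(1)[OF M that] \<open>finite S\<close> finite_subset by blast
  qed
  ultimately show ?thesis using matching_onD(2)[OF M] by simp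
qed

lemma ncm_matching: "M \<in> ncm S \<Longrightarrow> matching_on S M"
  by (simp add: ncm_def)

lemma ncm_noncrossing:
  "M \<in> ncm S \<Longrightarrow> e \<in> M \<Longrightarrow> f \<in> M \<Longrightarrow> e \<noteq> f \<Longrightarrow> f \<subseteq> between e \<or> f \<inter> between e = {}"
  by (simp add: ncm_def)

lemma finite_ncm: "finite S \<Longrightarrow> finite (ncm S)"
  by (rule finite_subset[of _ "Pow (Pow S)"]) (auto dest: ncm_matching matching_onD(1))

lemma ncm_subset:
  assumes M: "M \<in> ncm S" and T: "T \<subseteq> S" "\<And>e. e \<in> M \<Longrightarrow> e \<inter> T \<noteq> {} \<Longrightarrow> e \<subseteq> T"
  shows "{e \<in> M. e \<subseteq> T} \<in> ncm T"
  using matching_on_subset[OF ncm_matching[OF M] T] ncm_noncrossing[OF M]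
  by (auto simp: ncm_def)

lemma ncm_empty: "ncm {} = {{}}"
  by (auto simp: ncm_def matching_on_def)

lemma ncm_sides:
  assumes M: "M \<in> ncm S" and g: "{k, l} \<in> M" "k < l" and f: "f \<in> M" "f \<noteq> {k, l}"
  shows "f \<subseteq> S \<inter> {k<..<l} \<or> f \<subseteq> S - {k..l}"
proof -
  have "k \<notin> f" "l \<notin> f" using matching_onD(3)[OF ncm_matching[OF M]] g f by blast+
  moreover have "f \<subseteq> S" using matching_onD(1)[OF ncm_matching[OF M] f(1)] .
  moreover have "f \<subseteq> {k<..<l} \<or> f \<inter> {k<..<l} = {}"
    using ncm_noncrossing[OF M g(1) f(1)] f g by (simp add: between_insert)
  moreover have "{k..l} = insert k (insert l {k<..<l})" using g(2) by auto
  ultimately show ?thesis by auto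
qed

text \<open>The two parts cannot cross each other: an edge of \<open>A\<close> spans only labels
  inside the chord, and the interval spanned by an edge of \<open>B\<close> contains
  \<open>{k..l}\<close> entirely or misses it.\<close>

lemma ncm_join:
  assumes kl: "k < l" "k \<in> S" "l \<in> S" and A: "A \<in> ncm (S \<inter> {k<..<l})" and B: "B \<in> ncm (S - {k..l})"
  shows "insert {k, l} (A \<union> B) \<in> ncm S"
proof -
  note mA = ncm_matching[OF A] and mB = ncm_matching[OF B]
  have Ain: "e \<subseteq> {k<..<l}" "e \<subseteq> S" if "e \<in> A" for e using matching_onD(1)[OF mA that] by auto
  have Bin: "e \<inter> {k..l} = {}" "e \<subseteq> S" if "e \<in> B" for e using matching_onD(1)[OF mB that] by auto
  have bA: "between e \<subseteq> {k<..<l}" if e: "e \<in> A" for e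
  proof -
    obtain i j where "i < j" "e = {i, j}" using matching_on_edge[OF mA e] .
    then show ?thesis using Ain(1)[OF e] by (auto simp: between_insert)
  qed
  have bB: "{k..l} \<subseteq> between e \<or> {k..l} \<inter> between e = {}" if e: "e \<in> B" for e
  proof -
    obtain i j where "i < j" "e = {i, j}" using matching_on_edge[OF mB e] .
    then show ?thesis using Bin(1)[OF e] kl by (auto simp: between_insert)
  qed
  have sub: "{k<..<l} \<subseteq> {k..l}" by auto
  have "matching_on S (insert {k, l} (A \<union> B))"
  proof (rule matching_onI)
    fix e assume "e \<in> insert {k, l} (A \<union> B)"
    then show "e \<subseteq> S \<and> card e = 2"
      using kl Ain(2) Bin(2) matching_onD(2)[OF mA] matching_onD(2)[OF mB] by auto
  next
    fix x assume "x \<in> S"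
    then consider "x = k" | "x = l" | "x \<in> S \<inter> {k<..<l}" | "x \<in> S - {k..l}"
      by (metis Diff_iff IntI atLeastAtMost_iff greaterThanLessThan_iff order_le_less)
    then show "\<exists>e\<in>insert {k, l} (A \<union> B). x \<in> e"
    proof cases
      case 3 then show ?thesis using matching_on_cover[OF mA] by (metis UnI1 insertI2)
    next
      case 4 then show ?thesis using matching_on_cover[OF mB] by (metis UnI2 insertI2)
    qed auto
  next
    fix e f x assume ef: "e \<in> insert {k, l} (A \<union> B)" "f \<in> insert {k, l} (A \<union> B)" and x: "x \<in> e" "x \<in> f"
    have d: "False" if "u \<in> A" "v \<in> B" "x \<in> u" "x \<in> v" for u v
      using Ain(1)[OF that(1)] Bin(1)[OF that(2)] that sub by blast
    have d': "False" if "u \<in> A \<union> B" "x \<in> u" "x \<in> {k, l}" for u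
    proof -
      have "x \<in> {k..l}" "x \<notin> {k<..<l}" using that kl by auto
      then show ?thesis using Ain(1)[of u] Bin(1)[of u] that(1,2) by blast
    qed
    show "e = f"
      using ef x d d' matching_onD(3)[OF mA] matching_onD(3)[OF mB] by (metis Un_iff insert_iff)
  qed
  moreover have "f \<subseteq> between e \<or> f \<inter> between e = {}"
    if ef: "e \<in> insert {k, l} (A \<union> B)" "f \<in> insert {k, l} (A \<union> B)" "e \<noteq> f" for e f
  proof -
    consider "e \<in> A" "f \<in> A" | "e \<in> B" "f \<in> B" | "e \<in> A" "f \<in> B" | "e \<in> B" "f \<in> A"
      | "e = {k, l}" "f \<in> A" | "e = {k, l}" "f \<in> B" | "e \<in> A" "f = {k, l}" | "e \<in> B" "f = {k, l}"
      using ef by (elim insertE UnE; blast)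
    then show ?thesis
    proof cases
      case 1 then show ?thesis using ncm_noncrossing[OF A] ef(3) by blast
    next
      case 2 then show ?thesis using ncm_noncrossing[OF B] ef(3) by blast
    next
      case 3 then show ?thesis using bA[of e] Bin(1)[of f] sub by blast
    next
      case 4 then show ?thesis using bB[of e] Ain(1)[of f] sub by blast
    next
      case 5 then show ?thesis using Ain(1)[of f] kl by (simp add: between_insert)
    next
      case 6 then show ?thesis using Bin(1)[of f] kl sub by (simp add: between_insert) blast
    next
      case 7 then show ?thesis using bA[of e] by auto
    next
      case 8
      have "f \<subseteq> {k..l}" using 8 kl by auto
      then show ?thesis using bB[of e] 8(1) by blast
    qed
  qed
  ultimately show ?thesis by (simp add: ncm_def)
qed

text \<open>The sets \<open>F1\<close> and \<open>F2\<close> prescribe edges inside and outside the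
  chord. Left empty, they give the recursion for the Catalan numbers; later they fix one more edge
  on a side.\<close>

lemma bij_betw_ncm_split:
  assumes kl: "k < l" "k \<in> S" "l \<in> S"
    and F: "F1 \<subseteq> Pow (S \<inter> {k<..<l}) - {{}}" "F2 \<subseteq> Pow (S - {k..l}) - {{}}"
  shows "bij_betw (\<lambda>(A, B). insert {k, l} (A \<union> B))
    ({A \<in> ncm (S \<inter> {k<..<l}). F1 \<subseteq> A} \<times> {B \<in> ncm (S - {k..l}). F2 \<subseteq> B})
    {M \<in> ncm S. {k, l} \<in> M \<and> F1 \<subseteq> M \<and> F2 \<subseteq> M}" (is "bij_betw ?j ?D ?R")
\<comment> \<open>The inverse sorts the edges other than \<open>{k, l}\<close> by the side of the
  chord on which they lie.\<close>
proof (rule bij_betw_byWitness[where f' = "\<lambda>M. ({e \<in> M. e \<subseteq> S \<inter> {k<..<l}}, {e \<in> M. e \<subseteq> S - {k..l}})"])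
  have ne: "e \<noteq> {}" if "M \<in> ncm T" "e \<in> M" for M T e
    using matching_onD(2)[OF ncm_matching[OF that(1)] that(2)] by auto
  show "\<forall>p\<in>?D. (\<lambda>M. ({e \<in> M. e \<subseteq> S \<inter> {k<..<l}}, {e \<in> M. e \<subseteq> S - {k..l}})) (?j p) = p"
  proof
    fix p assume "p \<in> ?D"
    then obtain A B where p: "p = (A, B)"
      and A: "A \<in> ncm (S \<inter> {k<..<l})" and B: "B \<in> ncm (S - {k..l})" by blast
    have Ain: "e \<subseteq> S \<inter> {k<..<l}" "e \<noteq> {}" if "e \<in> A" for e
      using matching_onD(1)[OF ncm_matching[OF A] that] ne[OF A that] by auto
    have Bin: "e \<subseteq> S - {k..l}" "e \<noteq> {}" if "e \<in> B" for e
      using matching_onD(1)[OF ncm_matching[OF B] that] ne[OF B that] by auto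
    have flt: "{e \<in> insert {k, l} (X \<union> Y). P e} = X"
      if "\<And>e. e \<in> X \<Longrightarrow> P e" "\<And>e. e \<in> Y \<Longrightarrow> \<not> P e" "\<not> P {k, l}" for X P Y
      using that by auto
    have disj: "(S \<inter> {k<..<l}) \<inter> (S - {k..l}) = {}" by auto
    have "\<not> e \<subseteq> S \<inter> {k<..<l}" if "e \<in> B" for e using Bin[OF that] disj by blast
    moreover have "\<not> e \<subseteq> S - {k..l}" if "e \<in> A" for e using Ain[OF that] disj by blast
    moreover have "\<not> {k, l} \<subseteq> S \<inter> {k<..<l}" "\<not> {k, l} \<subseteq> S - {k..l}" using kl(1) by auto
    ultimately have "{e \<in> insert {k, l} (A \<union> B). e \<subseteq> S \<inter> {k<..<l}} = A"
      "{e \<in> insert {k, l} (A \<union> B). e \<subseteq> S - {k..l}} = B"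
      using flt[of A "\<lambda>e. e \<subseteq> S \<inter> {k<..<l}" B] flt[of B "\<lambda>e. e \<subseteq> S - {k..l}" A] Ain(1) Bin(1)
      by (simp_all only: Un_commute) metis+
    then show "({e \<in> ?j p. e \<subseteq> S \<inter> {k<..<l}}, {e \<in> ?j p. e \<subseteq> S - {k..l}}) = p"
      by (simp add: p)
  qed
  show "\<forall>M\<in>?R. ?j ({e \<in> M. e \<subseteq> S \<inter> {k<..<l}}, {e \<in> M. e \<subseteq> S - {k..l}}) = M"
    using ncm_sides kl(1) by fastforce
  show "?j ` ?D \<subseteq> ?R" using ncm_join[OF kl] by auto
  show "(\<lambda>M. ({e \<in> M. e \<subseteq> S \<inter> {k<..<l}}, {e \<in> M. e \<subseteq> S - {k..l}})) ` ?R \<subseteq> ?D"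
  proof (intro image_subsetI)
    fix M assume "M \<in> ?R"
    then have M: "M \<in> ncm S" "{k, l} \<in> M" "F1 \<subseteq> M" "F2 \<subseteq> M" by auto
    have "e \<subseteq> S \<inter> {k<..<l} \<or> e \<subseteq> S - {k..l} \<or> e = {k, l}" if "e \<in> M" for e
      using ncm_sides[OF M(1,2) kl(1) that] by blast
    then have 1: "e \<inter> (S \<inter> {k<..<l}) \<noteq> {} \<Longrightarrow> e \<subseteq> S \<inter> {k<..<l}"
       and 2: "e \<inter> (S - {k..l}) \<noteq> {} \<Longrightarrow> e \<subseteq> S - {k..l}" if "e \<in> M" for e
      using that kl(1) by fastforce+
    show "({e \<in> M. e \<subseteq> S \<inter> {k<..<l}}, {e \<in> M. e \<subseteq> S - {k..l}}) \<in> ?D"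
      using ncm_subset[OF M(1) _ 1] ncm_subset[OF M(1) _ 2] M(3,4) F by auto
  qed
qed

lemma card_ncm_split:
  assumes "k < l" "k \<in> S" "l \<in> S"
    and "F1 \<subseteq> Pow (S \<inter> {k<..<l}) - {{}}" "F2 \<subseteq> Pow (S - {k..l}) - {{}}"
  shows "card {M \<in> ncm S. {k, l} \<in> M \<and> F1 \<subseteq> M \<and> F2 \<subseteq> M} =
    card {A \<in> ncm (S \<inter> {k<..<l}). F1 \<subseteq> A} * card {B \<in> ncm (S - {k..l}). F2 \<subseteq> B}"
  using bij_betw_same_card[OF bij_betw_ncm_split[OF assms]] by (simp add: card_cartesian_product)

section \<open>The Catalan recurrence\<close>

lemma central_binomial_Suc:
  "real ((2 * Suc i) choose Suc i) * (real i + 1) = 2 * (2 * real i + 1) * real ((2 * i) choose i)"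
proof -
  have "real ((2 * Suc i) choose Suc i) = fact (2 * Suc i) / (fact (Suc i) * fact (Suc i))"
    by (subst binomial_fact) auto
  also have "(fact (2 * Suc i) :: real) = (2 * real i + 2) * (2 * real i + 1) * fact (2 * i)"
    by (simp add: algebra_simps)
  also have "(fact (Suc i) :: real) = (real i + 1) * fact i" by simp
  finally have *: "real ((2 * Suc i) choose Suc i) =
      (2 * real i + 2) * (2 * real i + 1) * fact (2 * i) / ((real i + 1) * fact i * ((real i + 1) * fact i))" .
  have "real ((2 * Suc i) choose Suc i) * (real i + 1) =
      2 * (2 * real i + 1) * (fact (2 * i) / (fact i * fact i))"
    unfolding * by (simp add: divide_simps) (simp add: algebra_simps)
  also have "fact (2 * i) / (fact i * fact i) = real ((2 * i) choose i)"
    by (subst binomial_fact) auto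
  finally show ?thesis .
qed

text \<open>The summand telescopes: it is the difference of consecutive values of \<open>G\<close>, which Gosper's
  algorithm produces.\<close>

lemma catalan_Suc: "catalan (Suc m) = (\<Sum>i\<le>m. catalan i * catalan (m - i))"
proof -
  define cb where "cb i = real ((2 * i) choose i)" for i
  define G where "G j = cb j * cb (Suc m - j) * (2 * real j - real m - 1) /
      (2 * (real m + 1) * (real m + 2))" for j
  have cb_Suc: "cb (Suc i) = 2 * (2 * real i + 1) * cb i / (real i + 1)" for i
    using central_binomial_Suc[of i] unfolding cb_def by (subst eq_divide_eq) auto
  have cat: "catalan i = cb i / (real i + 1)" for i by (simp add: catalan_def cb_def)
  have step: "catalan i * catalan (m - i) = G (Suc i) - G i" if le: "i \<le> m" for i
  proof -
    \<comment> \<open>In terms of \<open>i\<close> and \<open>q\<close> no truncated subtraction is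
      left, and the claim becomes an identity of rational functions.\<close>
    obtain q where q: "m = i + q" using le_Suc_ex[OF le] by auto
    have "Suc m - i = Suc q" "Suc m - Suc i = q" "m - i = q" using q by auto
    then have
      "G (Suc i) = cb i * cb q * (2 * (2 * real i + 1) / (real i + 1) * (real i - real q + 1)) /
        (2 * (real i + real q + 1) * (real i + real q + 2))"
      "G i = cb i * cb q * (2 * (2 * real q + 1) / (real q + 1) * (real i - real q - 1)) /
        (2 * (real i + real q + 1) * (real i + real q + 2))"
      by (simp_all add: G_def cb_Suc q mult.assoc)
    then have "G (Suc i) - G i = cb i * cb q * (2 * (2 * real i + 1) / (real i + 1) * (real i - real q + 1)
        - 2 * (2 * real q + 1) / (real q + 1) * (real i - real q - 1))
        / (2 * (real i + real q + 1) * (real i + real q + 2))"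
      by (simp only: right_diff_distrib diff_divide_distrib)
    also have "2 * (2 * real i + 1) / (real i + 1) * (real i - real q + 1)
        - 2 * (2 * real q + 1) / (real q + 1) * (real i - real q - 1)
        = 2 * (real i + real q + 1) * (real i + real q + 2) / ((real i + 1) * (real q + 1))"
    proof -
      have ne: "real i + 1 \<noteq> 0" "real q + 1 \<noteq> 0" by linarith+
      show ?thesis using ne by (simp add: divide_simps) (simp add: algebra_simps)
    qed
    also have "cb i * cb q * (2 * (real i + real q + 1) * (real i + real q + 2) / ((real i + 1) * (real q + 1)))
       / (2 * (real i + real q + 1) * (real i + real q + 2)) = cb i / (real i + 1) * (cb q / (real q + 1))"
    proof -
      have "real i + real q + 1 > 0" "real i + real q + 2 > 0" by linarith+
      then have "2 * (real i + real q + 1) * (real i + real q + 2) \<noteq> 0" by simp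
      then show ?thesis by simp
    qed
    finally show ?thesis using q by (simp add: cat)
  qed
  have "(\<Sum>i\<le>m. catalan i * catalan (m - i)) = (\<Sum>i<Suc m. G (Suc i) - G i)"
    by (simp add: step lessThan_Suc_atMost)
  also have "\<dots> = G (Suc m) - G 0" by (rule sum_lessThan_telescope)
  \<comment> \<open>Since \<open>G\<close> is antisymmetric under the exchange of \<open>j\<close>
    and \<open>m + 1 - j\<close>, both ends of the telescope contribute the same amount.\<close>
  also have "\<dots> = cb (Suc m) / (real m + 2)"
  proof -
    have ne: "real m + 1 > 0" "real m + 2 > 0" by linarith+
    have "cb 0 = 1" by (simp add: cb_def)
    then have "G (Suc m) = cb (Suc m) * (real m + 1) / (2 * (real m + 1) * (real m + 2))"
      "G 0 = - (cb (Suc m) * (real m + 1) / (2 * (real m + 1) * (real m + 2)))"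
      unfolding G_def by (simp_all add: algebra_simps add_divide_distrib diff_divide_distrib)
    then have "G (Suc m) - G 0 = 2 * (cb (Suc m) * (real m + 1) / (2 * (real m + 1) * (real m + 2)))"
      by simp
    also have "2 * (c * a / (2 * a * b)) = c / b" if "a > 0" "b > 0" for a b c :: real
      using that by (simp add: divide_simps)
    then have "2 * (cb (Suc m) * (real m + 1) / (2 * (real m + 1) * (real m + 2))) = cb (Suc m) / (real m + 2)"
      using ne by blast
    finally show ?thesis .
  qed
  finally show ?thesis by (simp add: cat algebra_simps)
qed

section \<open>Catalan numbers count non-crossing matchings\<close>

lemma ncm_odd_empty: "finite S \<Longrightarrow> odd (card S) \<Longrightarrow> ncm S = {}"
  using card_matching_on ncm_matching by (metis dvd_triv_left equals0I)

lemma sum_even_indices: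
  "(\<Sum>i<Suc (2 * q). if even i then h (i div 2) else 0) = (\<Sum>j\<le>q. h j)"
  for h :: "nat \<Rightarrow> real"
  by (induction q) auto

text \<open>The partners of the smallest label need not form an interval; replacing each by its rank
  makes the sum over partners a sum over consecutive indices.\<close>

lemma bij_betw_rank:
  assumes "finite (S :: nat set)"
  shows "bij_betw (\<lambda>p. card (S \<inter> {..<p})) S {..<card S}"
proof -
  have less: "card (S \<inter> {..<p}) < card (S \<inter> {..<q})" if "p < q" "p \<in> S" for p q
    using assms that by (intro psubset_card_mono) auto
  have inj: "inj_on (\<lambda>p. card (S \<inter> {..<p})) S"
    by (rule linorder_inj_onI) (use less in \<open>auto, fastforce\<close>)
  moreover have "(\<lambda>p. card (S \<inter> {..<p})) ` S \<subseteq> {..<card S}"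
    using assms by (auto intro!: psubset_card_mono)
  then have "(\<lambda>p. card (S \<inter> {..<p})) ` S = {..<card S}"
    using card_image[OF inj] by (intro card_subset_eq) auto
  ultimately show ?thesis by (simp add: bij_betw_def)
qed

text \<open>The edge at the smallest label \<open>x\<close> separates the labels below its other
  endpoint \<open>p\<close> from those above, and the two groups are matched independently. This is
  the Catalan recurrence, indexed by the size of the lower group.\<close>

lemma card_ncm:
  assumes "finite S" "card S = 2 * m"
  shows "real (card (ncm S)) = catalan m"
  using assms
proof (induction m arbitrary: S rule: less_induct)
  case (less m S)
  show ?case
  proof (cases m)
    case 0
    then show ?thesis using less.prems by (simp add: ncm_empty catalan_def)
  next
    case (Suc q)
    define x where "x = Min S"
    define S' where "S' = S - {x}"
    have "S \<noteq> {}" using less.prems Suc by auto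
    then have x: "x \<in> S" "\<And>y. y \<in> S \<Longrightarrow> x \<le> y" using less.prems by (auto simp: x_def)
    have S': "finite S'" "card S' = Suc (2 * q)" "x \<notin> S'" using less.prems Suc x by (auto simp: S'_def)
    have gt: "x < p" if "p \<in> S'" for p using that x(2)[of p] by (auto simp: S'_def)
    \<comment> \<open>The value 0 at odd arguments lets the sum range over all partners
      \<open>p\<close>, including those that leave an odd number of labels on each side.\<close>
    define c where "c i = (if even i then catalan (i div 2) else 0)" for i
    have c: "real (card (ncm T)) = c (card T)" if "T \<subseteq> S'" "card T \<le> 2 * q" for T
    proof (cases "even (card T)")
      case True
      then obtain t where t: "card T = 2 * t" by blast
      then show ?thesis
        using less.IH[of t T] that Suc finite_subset[OF that(1) S'(1)] by (simp add: c_def)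
    next
      case False
      then show ?thesis
        using ncm_odd_empty[of T] finite_subset[OF that(1) S'(1)] by (simp add: c_def)
    qed
    have sizes: "real (card (ncm (S \<inter> {x<..<p})) * card (ncm (S - {x..p}))) =
        (\<lambda>i. c i * c (2 * q - i)) (card (S' \<inter> {..<p}))" if p: "p \<in> S'" for p
    proof -
      have eq: "S \<inter> {x<..<p} = S' \<inter> {..<p}" "S - {x..p} = S' - insert p (S' \<inter> {..<p})"
        using x gt gt[OF p] by (auto simp: S'_def le_less)
      have "card (insert p (S' \<inter> {..<p})) = Suc (card (S' \<inter> {..<p}))" using S' by simp
      \<comment> \<open>Of the \<open>2 * q + 1\<close> labels other than \<open>x\<close>, the
        partner \<open>p\<close> and the labels below it are removed.\<close>
      then have "card (S' - insert p (S' \<inter> {..<p})) = 2 * q - card (S' \<inter> {..<p})"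
        using p S' by (subst card_Diff_subset) auto
      moreover have "card (S' \<inter> {..<p}) < card S'" using p S' by (intro psubset_card_mono) auto
      ultimately show ?thesis unfolding eq using S' c[of "S' \<inter> {..<p}"]
          c[of "S' - insert p (S' \<inter> {..<p})"] by auto
    qed
    have disj: "{M \<in> ncm S. {x, p} \<in> M} \<inter> {M \<in> ncm S. {x, p'} \<in> M} = {}"
      if "p \<in> S'" "p' \<in> S'" "p \<noteq> p'" for p p'
    proof -
      have "{x, p} \<noteq> {x, p'}" using that S' by (auto simp: doubleton_eq_iff)
      then show ?thesis using matching_onD(3)[OF ncm_matching] by blast
    qed
    have "ncm S = (\<Union>p\<in>S'. {M \<in> ncm S. {x, p} \<in> M})"
    proof safe
      fix M assume M: "M \<in> ncm S"
      obtain e where e: "e \<in> M" "x \<in> e" using matching_on_cover[OF ncm_matching[OF M] x(1)] .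
      obtain i j where ij: "i < j" "e = {i, j}" "i \<in> S" "j \<in> S"
        using matching_on_edge[OF ncm_matching[OF M] e(1)] .
      have "i = x" using ij e(2) x(2)[of i] by auto
      then show "M \<in> (\<Union>p\<in>S'. {M \<in> ncm S. {x, p} \<in> M})" using ij e M by (auto simp: S'_def)
    qed
    then have "card (ncm S) = card (\<Union>p\<in>S'. {M \<in> ncm S. {x, p} \<in> M})" by simp
    also have "\<dots> = (\<Sum>p\<in>S'. card {M \<in> ncm S. {x, p} \<in> M})"
    proof (rule card_UN_disjoint, goal_cases)
      case 1 show ?case by (fact S'(1))
    next
      case 2 show ?case using finite_ncm[OF less.prems(1)] by simp
    next
      case 3 show ?case using disj by blast
    qed
    also have "\<dots> = (\<Sum>p\<in>S'. card (ncm (S \<inter> {x<..<p})) * card (ncm (S - {x..p})))"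
    proof (rule sum.cong)
      fix p assume "p \<in> S'"
      then show "card {M \<in> ncm S. {x, p} \<in> M} = card (ncm (S \<inter> {x<..<p})) * card (ncm (S - {x..p}))"
        using card_ncm_split[of x p S "{}" "{}"] x gt by (simp add: S'_def)
    qed simp
    finally have "real (card (ncm S)) = (\<Sum>p\<in>S'. (\<lambda>i. c i * c (2 * q - i)) (card (S' \<inter> {..<p})))"
      using sizes by simp
    also have "\<dots> = (\<Sum>i<Suc (2 * q). c i * c (2 * q - i))"
      using sum.reindex_bij_betw[OF bij_betw_rank[OF S'(1)], of "\<lambda>i. c i * c (2 * q - i)"] S' by simp
    also have "\<dots> = (\<Sum>i<Suc (2 * q). if even i then catalan (i div 2) * catalan (q - i div 2) else 0)"
    proof (rule sum.cong)
      fix i assume "i \<in> {..<Suc (2 * q)}"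
      then have "(2 * q - i) div 2 = q - i div 2" "even (2 * q - i)" if "even i" using that by auto
      then show "c i * c (2 * q - i) = (if even i then catalan (i div 2) * catalan (q - i div 2) else 0)"
        by (simp add: c_def)
    qed simp
    also have "\<dots> = catalan (Suc q)"
      unfolding catalan_Suc by (rule sum_even_indices[of "\<lambda>j. catalan j * catalan (q - j)" q])
    finally show ?thesis using Suc by simp
  qed
qed

section \<open>Flips\<close>

lemma pt_hull_edge_disjoint_iff:
  assumes "card e = 2" "e \<subseteq> {..<2 * n}" "S \<subseteq> {..<2 * n}" "S \<inter> e = {}"
  shows "pt_hull n e \<inter> pt_hull n S = {} \<longleftrightarrow> S \<subseteq> between e \<or> S \<inter> between e = {}"
proof -
  obtain i j where "i < j" "e = {i, j}" using card_2_ordered[OF assms(1)] .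
  then show ?thesis using pt_hull_disjoint_iff[of i j n S] assms by (auto simp: between_insert)
qed

lemma perfect_matching_iff: "perfect_matching n M \<longleftrightarrow> matching_on {..<2 * n} M"
  by (simp add: perfect_matching_def matching_on_def Ball_def)

lemma matchings_eq_ncm: "matchings n = ncm {..<2 * n}"
proof -
  have "noncrossing n M \<longleftrightarrow>
      (\<forall>e\<in>M. \<forall>f\<in>M. e \<noteq> f \<longrightarrow> f \<subseteq> between e \<or> f \<inter> between e = {})"
    if M: "matching_on {..<2 * n} M" for M
  proof -
    have *: "pt_hull n e \<inter> pt_hull n f = {} \<longleftrightarrow> f \<subseteq> between e \<or> f \<inter> between e = {}"
      if "e \<in> M" "f \<in> M" "e \<noteq> f" for e f
    proof -
      have "f \<inter> e = {}" using matching_onD(3)[OF M that(1,2)] that(3) by blast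
      then show ?thesis
        by (intro pt_hull_edge_disjoint_iff matching_onD(1,2)[OF M] that(1,2))
    qed
    show ?thesis unfolding noncrossing_def by (intro ball_cong imp_cong refl *)
  qed
  then show ?thesis unfolding matchings_def ncm_def perfect_matching_iff
    by (intro Collect_cong conj_cong refl)
qed

lemma matchings_matching: "M \<in> matchings n \<Longrightarrow> matching_on {..<2 * n} M"
  by (simp add: matchings_def perfect_matching_iff)

lemma finite_matchings: "finite (matchings n)"
  by (simp add: matchings_eq_ncm finite_ncm)

text \<open>Of the six pairs of corners, only the diagonals \<open>{a, c}\<close> and
  \<open>{b, d}\<close> have a corner on either side, so exactly these fail to be edges of the
  hull.\<close>

lemma quadrilateral_edges_ordered:
  assumes "a < b" "b < c" "c < d" "d < 2 * n" "e \<union> f = {a, b, c, d}"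
  shows "quadrilateral_edges n e f = {{a, b}, {b, c}, {c, d}, {a, d}}"
proof -
  have S: "{a, b, c, d} \<subseteq> {..<2 * n}" using assms by auto
  have iff: "pt_hull n {k, l} edge_of pt_hull n {a, b, c, d} \<longleftrightarrow>
      {a, b, c, d} - {k, l} \<subseteq> {k<..<l} \<or> {a, b, c, d} \<inter> {k<..<l} = {}"
    if "k < l" "k \<in> {a, b, c, d}" "l \<in> {a, b, c, d}" for k l
    using that S by (intro pt_hull_edge_of_iff) auto
  show ?thesis unfolding quadrilateral_edges_def assms(5)
  proof (intro equalityI subsetI)
    fix g assume "g \<in> {g. g \<subseteq> {a, b, c, d} \<and> card g = 2 \<and> pt_hull n g edge_of pt_hull n {a, b, c, d}}"
    then have g: "g \<subseteq> {a, b, c, d}" "card g = 2" "pt_hull n g edge_of pt_hull n {a, b, c, d}" by auto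
    obtain k l where kl: "k < l" "g = {k, l}" using card_2_ordered[OF g(2)] .
    have kl': "k \<in> {a, b, c, d}" "l \<in> {a, b, c, d}" using g kl by auto
    then have side: "{a, b, c, d} - {k, l} \<subseteq> {k<..<l} \<or> {a, b, c, d} \<inter> {k<..<l} = {}"
      using iff[OF kl(1) kl'] g(3) kl by blast
    have "b \<in> {a<..<c}" "d \<notin> {a, c}" "d \<notin> {a<..<c}" "c \<in> {b<..<d}" "a \<notin> {b, d}" "a \<notin> {b<..<d}"
      using assms(1-3) by auto
    then have ac: "\<not> (k = a \<and> l = c)" and bd: "\<not> (k = b \<and> l = d)" using side by blast+
    have "a \<le> k" using kl'(1) assms(1-3) by auto
    then have "l = b \<or> l = c \<or> l = d" using kl(1) kl'(2) by auto
    then have "k = a \<and> l = b \<or> k = b \<and> l = c \<or> k = c \<and> l = d \<or> k = a \<and> l = d"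
    proof (elim disjE)
      assume "l = b"
      then have "k = a" using kl(1) kl'(1) assms(1-3) by auto
      then show ?thesis using \<open>l = b\<close> by blast
    next
      assume "l = c"
      then have "k = b" using kl(1) kl'(1) ac assms(1-3) by auto
      then show ?thesis using \<open>l = c\<close> by blast
    next
      assume "l = d"
      then have "k = a \<or> k = c" using kl(1) kl'(1) bd assms(1-3) by auto
      then show ?thesis using \<open>l = d\<close> by blast
    qed
    then show "g \<in> {{a, b}, {b, c}, {c, d}, {a, d}}" unfolding kl(2) by blast
  next
    fix g assume "g \<in> {{a, b}, {b, c}, {c, d}, {a, d}}"
    then consider "g = {a, b}" | "g = {b, c}" | "g = {c, d}" | "g = {a, d}" by auto
    then show "g \<in> {g. g \<subseteq> {a, b, c, d} \<and> card g = 2 \<and> pt_hull n g edge_of pt_hull n {a, b, c, d}}"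
      by cases (use assms(1-3) iff in auto)
  qed
qed

text \<open>As \<open>e\<close> and \<open>f\<close> do not cross, they are not the two diagonals
  but a pair of opposite sides of the quadrilateral; the other pair of opposite sides is what the
  flip inserts.\<close>

lemma complementary_sides:
  assumes ef: "card e = 2" "card f = 2" "e \<subseteq> {..<2 * n}" "f \<subseteq> {..<2 * n}" "e \<inter> f = {}"
    and nc: "f \<subseteq> between e \<or> f \<inter> between e = {}"
  obtains e' f' where "card e' = 2" "card f' = 2" "e' \<inter> f' = {}" "e' \<union> f' = e \<union> f"
    "{e', f'} \<inter> {e, f} = {}" "quadrilateral_edges n e f = {e, f, e', f'}"
    "pt_hull n e' \<inter> pt_hull n f' = {}"
proof -
  obtain i j where ij: "i < j" "e = {i, j}" using card_2_ordered[OF ef(1)] .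
  obtain k l where kl: "k < l" "f = {k, l}" using card_2_ordered[OF ef(2)] .
  note intro = that
  \<comment> \<open>Here \<open>a < b < c < d\<close> are the sorted corners and \<open>u\<close>,
    \<open>v\<close> are \<open>e\<close>, \<open>f\<close> in a suitable order, so that only the
    separated and the nested shape remain to be treated.\<close>
  have goal: thesis if abcd: "a < b" "b < c" "c < d" "d < 2 * n"
    and uv: "u = {a, b} \<and> v = {c, d} \<and> e' = {a, d} \<and> f' = {b, c} \<or>
      u = {a, d} \<and> v = {b, c} \<and> e' = {a, b} \<and> f' = {c, d}"
    and ef_uv: "e = u \<and> f = v \<or> e = v \<and> f = u"
    for a b c d u v e' f'
  proof -
    have U: "u \<union> v = {a, b, c, d}" "e' \<union> f' = {a, b, c, d}"
      using uv by (elim disjE conjE; simp add: insert_commute)+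
    then have U': "e \<union> f = {a, b, c, d}" using ef_uv by (elim disjE conjE) (simp_all add: Un_commute)
    have "{{a, b}, {b, c}, {c, d}, {a, d}} = {u, v, e', f'}"
      using uv by (elim disjE conjE; simp add: insert_commute)
    also have "\<dots> = {e, f, e', f'}" using ef_uv by (elim disjE conjE) (simp_all add: insert_commute)
    finally have Q: "quadrilateral_edges n e f = {e, f, e', f'}"
      using quadrilateral_edges_ordered[OF abcd U'] by simp
    have "pt_hull n {a, b} \<inter> pt_hull n {c, d} = {}" "pt_hull n {a, d} \<inter> pt_hull n {b, c} = {}"
      using abcd by (subst pt_hull_disjoint_iff; auto)+
    then have D: "pt_hull n e' \<inter> pt_hull n f' = {}"
      using uv by (elim disjE conjE) simp_all
    have C: "card e' = 2" "card f' = 2" "e' \<inter> f' = {}"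
      using uv abcd by (elim disjE conjE; simp)+
    have "{e', f'} \<inter> {u, v} = {}"
      using uv abcd by (elim disjE conjE; simp add: doubleton_eq_iff)
    moreover have "{u, v} = {e, f}" using ef_uv by blast
    ultimately show thesis using intro[OF C _ _ Q D] U U' by simp
  qed
  have ne: "i \<noteq> k" "i \<noteq> l" "j \<noteq> k" "j \<noteq> l" using ef(5) ij kl by auto
  have lt: "j < 2 * n" "l < 2 * n" using ef ij kl by auto
  have "(i < k \<and> l < j) \<or> j < k \<or> l < i \<or> (k < i \<and> j < l)"
    using nc ne ij kl by (auto simp: between_insert)
  then consider "i < k" "l < j" | "j < k" | "l < i" | "k < i" "j < l" by blast
  then show thesis
  proof cases
    case 1
    show ?thesis
      by (rule goal[of i k l j "{i, j}" "{k, l}" "{i, k}" "{l, j}"]) (use 1 ij kl lt in simp_all)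
  next
    case 2
    show ?thesis
      by (rule goal[of i j k l "{i, j}" "{k, l}" "{i, l}" "{j, k}"]) (use 2 ij kl lt in simp_all)
  next
    case 3
    show ?thesis
      by (rule goal[of k l i j "{k, l}" "{i, j}" "{k, j}" "{l, i}"]) (use 3 ij kl lt in simp_all)
  next
    case 4
    show ?thesis
      by (rule goal[of k i j l "{k, l}" "{i, j}" "{k, i}" "{j, l}"]) (use 4 ij kl lt in simp_all)
  qed
qed

text \<open>The pairs are unordered because a flip does not depend on the order of its two edges;
  counting them gives the degree.\<close>

definition centered_pairs :: "nat \<Rightarrow> nat set set \<Rightarrow> nat set set set" where
  "centered_pairs n M = {{e, f} | e f. empty_quadrilateral n M e f \<and> 0 \<in> pt_hull n (e \<union> f)}"

lemma centered_pairsI: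
  "empty_quadrilateral n M e f \<Longrightarrow> 0 \<in> pt_hull n (e \<union> f) \<Longrightarrow> {e, f} \<in> centered_pairs n M"
  unfolding centered_pairs_def by blast

text \<open>A flip keeps the four corners, hence also the hull and its emptiness, so flipping the
  new pair restores \<open>M\<close>. The new edges avoid the rest of \<open>M\<close> because they
  lie in the empty hull.\<close>

lemma flip_properties:
  assumes M: "M \<in> matchings n" and E: "empty_quadrilateral n M e f"
  obtains e' f' where "e' \<union> f' = e \<union> f" "e' \<notin> M" "f' \<notin> M" "e' \<noteq> f'"
    "flip n M e f = (M - {e, f}) \<union> {e', f'}" "flip n M e f \<in> matchings n"
    "empty_quadrilateral n (flip n M e f) e' f'" "flip n (flip n M e f) e' f' = M"
proof -
  note mM = matchings_matching[OF M]
  have ef: "e \<in> M" "f \<in> M" "e \<noteq> f" using E by (auto simp: empty_quadrilateral_def)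
  have disj: "e \<inter> f = {}" using matching_onD(3)[OF mM ef(1,2)] ef(3) by blast
  have "f \<subseteq> between e \<or> f \<inter> between e = {}"
    using M ef ncm_noncrossing unfolding matchings_eq_ncm by blast
  then obtain e' f' where c: "card e' = 2" "card f' = 2" "e' \<inter> f' = {}" "e' \<union> f' = e \<union> f"
    "{e', f'} \<inter> {e, f} = {}" "quadrilateral_edges n e f = {e, f, e', f'}"
    "pt_hull n e' \<inter> pt_hull n f' = {}"
    using complementary_sides[OF matching_onD(2)[OF mM ef(1)] matching_onD(2)[OF mM ef(2)]
        matching_onD(1)[OF mM ef(1)] matching_onD(1)[OF mM ef(2)] disj] by blast
  have notM: "g \<notin> M" if g: "g \<in> {e', f'}" for g
  proof
    assume "g \<in> M"
    have "g \<subseteq> e' \<union> f'" "card g = 2" using g c(1,2) by auto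
    then have "g \<noteq> {}" "g \<subseteq> e \<union> f" using c(4) by auto
    then obtain x where "x \<in> g" "x \<in> e \<or> x \<in> f" by blast
    then have "g = e \<or> g = f" using matching_onD(3)[OF mM \<open>g \<in> M\<close>] ef by blast
    then show False using c(5) g by auto
  qed
  define N where "N = (M - {e, f}) \<union> {e', f'}"
  have N: "flip n M e f = N" using c(5,6) by (auto simp: flip_def N_def)
  have mN: "matching_on {..<2 * n} N"
  proof (rule matching_onI)
    fix g assume "g \<in> N"
    moreover have "e \<union> f \<subseteq> {..<2 * n}" using matching_onD(1)[OF mM] ef by blast
    ultimately show "g \<subseteq> {..<2 * n} \<and> card g = 2"
      using matching_onD(1,2)[OF mM, of g] c(1,2,4) unfolding N_def by blast
  next
    fix x assume "x \<in> {..<2 * n}"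
    then obtain g where "g \<in> M" "x \<in> g" using matching_on_cover[OF mM] by blast
    then show "\<exists>g\<in>N. x \<in> g" using c(4) unfolding N_def by blast
  next
    fix g h x assume gh: "g \<in> N" "h \<in> N" and x: "x \<in> g" "x \<in> h"
    have d: False if "u \<in> M - {e, f}" "v \<in> {e', f'}" "x \<in> u" "x \<in> v" for u v
    proof -
      have "x \<in> e \<or> x \<in> f" using that(2,4) c(4) by blast
      then show ?thesis using that(1,3) ef matching_onD(3)[OF mM] by blast
    qed
    consider "g \<in> M" "h \<in> M" | "g \<in> {e', f'}" "h \<in> {e', f'}"
      using gh x d[of g h] d[of h g] unfolding N_def by blast
    then show "g = h"
      by cases (use x c(3) matching_onD(3)[OF mM] in auto)
  qed
  have "noncrossing n M" using M by (simp add: matchings_def)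
  have side: "pt_hull n g \<inter> pt_hull n h = {}" if "g \<in> M - {e, f}" "h \<in> {e', f'}" for g h
  proof -
    have "pt_hull n h \<subseteq> pt_hull n (e \<union> f)" using that(2) c(4) by (intro pt_hull_mono) blast
    then show ?thesis using E that(1) unfolding empty_quadrilateral_def by blast
  qed
  have "noncrossing n N"
    unfolding noncrossing_def
  proof (intro ballI impI)
    fix g h assume gh: "g \<in> N" "h \<in> N" "g \<noteq> h"
    then consider "g \<in> M" "h \<in> M" | "g \<in> M - {e, f}" "h \<in> {e', f'}" | "h \<in> M - {e, f}" "g \<in> {e', f'}"
      | "g = e'" "h = f'" | "g = f'" "h = e'"
      unfolding N_def by (elim UnE insertE emptyE DiffE; blast)
    then show "pt_hull n g \<inter> pt_hull n h = {}"
    proof cases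
      case 1 then show ?thesis using \<open>noncrossing n M\<close> gh(3) unfolding noncrossing_def by blast
    next
      case 2 then show ?thesis using side by blast
    next
      case 3 then show ?thesis using side[OF 3] by blast
    qed (use c(7) in auto)
  qed
  then have NM: "N \<in> matchings n" using mN by (simp add: matchings_def perfect_matching_iff)
  have ne: "e' \<noteq> f'" using c by auto
  have NN: "N - {e', f'} = M - {e, f}" using notM unfolding N_def by blast
  have "empty_quadrilateral n N e' f'"
    using E ne NN c(4) unfolding empty_quadrilateral_def by (auto simp: N_def)
  moreover have "quadrilateral_edges n e' f' = quadrilateral_edges n e f"
    unfolding quadrilateral_edges_def c(4) ..
  then have "flip n N e' f' = M" using c(5,6) ef NN unfolding flip_def by auto
  ultimately show thesis using that[of e' f'] c(4) notM ne N NM N_def by auto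
qed

text \<open>The edges missing after a flip are exactly the flipped pair, so different pairs lead to
  different neighbours.\<close>

lemma H_degree_eq_card_centered_pairs:
  assumes M: "M \<in> matchings n"
  shows "H_degree n M = card (centered_pairs n M)"
proof -
  \<comment> \<open>Writing the flip in terms of the union of the pair makes it a function of the
    unordered pair.\<close>
  define flp where "flp \<pi> = (M - \<pi>) \<union>
    ({g. g \<subseteq> \<Union>\<pi> \<and> card g = 2 \<and> pt_hull n g edge_of pt_hull n (\<Union>\<pi>)} - \<pi>)" for \<pi>
  have flp: "flp {e, f} = flip n M e f" for e f
    by (simp add: flp_def flip_def quadrilateral_edges_def)
  have diff: "M - flp \<pi> = \<pi>" if pi: "\<pi> \<in> centered_pairs n M" for \<pi>
  proof -
    obtain e f where \<pi>: "\<pi> = {e, f}" and E: "empty_quadrilateral n M e f"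
      using pi unfolding centered_pairs_def by blast
    obtain e' f' where "e' \<notin> M" "f' \<notin> M" "flip n M e f = (M - {e, f}) \<union> {e', f'}"
      by (rule flip_properties[OF M E], rule that)
    moreover have "e \<in> M" "f \<in> M" using E by (auto simp: empty_quadrilateral_def)
    ultimately show ?thesis unfolding \<pi> flp by auto
  qed
  have "inj_on (\<lambda>\<pi>. {M, flp \<pi>}) (centered_pairs n M)"
  proof (rule inj_onI)
    fix \<pi> \<rho> assume *: "\<pi> \<in> centered_pairs n M" "\<rho> \<in> centered_pairs n M" "{M, flp \<pi>} = {M, flp \<rho>}"
    then have "flp \<pi> = flp \<rho>" by (auto simp: doubleton_eq_iff)
    then have "M - flp \<pi> = M - flp \<rho>" by (rule arg_cong)
    then show "\<pi> = \<rho>" unfolding diff[OF *(1)] diff[OF *(2)] .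
  qed
  moreover have "{E \<in> H_edges n. M \<in> E} = (\<lambda>\<pi>. {M, flp \<pi>}) ` centered_pairs n M"
  proof (intro equalityI subsetI)
    fix E assume "E \<in> {E \<in> H_edges n. M \<in> E}"
    then obtain A B where AB: "E = {A, B}" "A \<in> matchings n" "centered_flip n A B" "M \<in> {A, B}"
      unfolding H_edges_def by blast
    then obtain e f where ef: "empty_quadrilateral n A e f" "0 \<in> pt_hull n (e \<union> f)" "B = flip n A e f"
      unfolding centered_flip_def by blast
    obtain e' f' where "e' \<union> f' = e \<union> f" "empty_quadrilateral n (flip n A e f) e' f'"
      "flip n (flip n A e f) e' f' = A"
      by (rule flip_properties[OF AB(2) ef(1)], rule that)
    note ef' = this[folded ef(3)]
    consider "M = A" | "M = B" using AB(4) by blast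
    then show "E \<in> (\<lambda>\<pi>. {M, flp \<pi>}) ` centered_pairs n M"
    proof cases
      case 1
      then have "{e, f} \<in> centered_pairs n M" "E = {M, flp {e, f}}"
        using ef AB(1) by (auto simp: centered_pairsI flp)
      then show ?thesis by blast
    next
      case 2
      then have "{e', f'} \<in> centered_pairs n M" "E = {M, flp {e', f'}}"
        using ef(2) ef' AB(1) by (auto simp: centered_pairsI flp)
      then show ?thesis by blast
    qed
  next
    fix E assume "E \<in> (\<lambda>\<pi>. {M, flp \<pi>}) ` centered_pairs n M"
    then obtain e f where ef: "empty_quadrilateral n M e f" "0 \<in> pt_hull n (e \<union> f)" "E = {M, flp {e, f}}"
      unfolding centered_pairs_def by blast
    have "flip n M e f \<in> matchings n" by (rule flip_properties[OF M ef(1)])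
    then show "E \<in> {E \<in> H_edges n. M \<in> E}"
      using M ef unfolding H_edges_def centered_flip_def flp by blast
  qed
  ultimately show ?thesis unfolding H_degree_def by (simp add: card_image)
qed

text \<open>Each side of an edge is matched within itself, so its labels are twice as many as its
  edges. The length is kept doubled to avoid halving.\<close>

lemma edge_length_eq:
  assumes M: "M \<in> matchings n" and e: "{i, j} \<in> M" "i < j"
  shows "odd (j - i)" and "2 * edge_length n M {i, j} = min (2 * n - 1 - (j - i)) (j - i - 1)"
proof -
  note mM = matchings_matching[OF M]
  have M': "M \<in> ncm {..<2 * n}" using M by (simp add: matchings_eq_ncm)
  have j: "j < 2 * n" using matching_onD(1)[OF mM e(1)] by auto
  have side: "f = {i, j} \<or> f \<subseteq> {..<2 * n} \<inter> {i<..<j} \<or> f \<subseteq> {..<2 * n} - {i..j}" if "f \<in> M" for f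
    using ncm_sides[OF M' e that] by blast
  have "matching_on ({..<2 * n} \<inter> {i<..<j}) {f \<in> M. f \<subseteq> {..<2 * n} \<inter> {i<..<j}}"
    by (rule matching_on_subset[OF mM]) (use side e in fastforce)+
  then have in': "card ({..<2 * n} \<inter> {i<..<j}) = 2 * card {f \<in> M. f \<subseteq> {..<2 * n} \<inter> {i<..<j}}"
    by (rule card_matching_on) simp
  have "matching_on ({..<2 * n} - {i..j}) {f \<in> M. f \<subseteq> {..<2 * n} - {i..j}}"
    by (rule matching_on_subset[OF mM]) (use side e in fastforce)+
  then have out': "card ({..<2 * n} - {i..j}) = 2 * card {f \<in> M. f \<subseteq> {..<2 * n} - {i..j}}"
    by (rule card_matching_on) simp
  have "{..<2 * n} \<inter> {i<..<j} = {i<..<j}" using j by auto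
  then have inn: "2 * card {f \<in> M. f \<subseteq> {..<2 * n} \<inter> {i<..<j}} = j - i - 1" using in' by simp
  have "card ({..<2 * n} - {i..j}) = 2 * n - 1 - (j - i)"
    using j e by (subst card_Diff_subset) auto
  then have out: "2 * card {f \<in> M. f \<subseteq> {..<2 * n} - {i..j}} = 2 * n - 1 - (j - i)" using out' by simp
  show "odd (j - i)"
    using inn e(2) by (metis dvd_triv_left even_Suc Suc_pred' zero_less_diff diff_Suc_1 One_nat_def)
  have "pt_hull n f \<subseteq> left_side (pt n i) (pt n j) \<longleftrightarrow> f \<subseteq> {..<2 * n} - {i..j}" if "f \<in> M" for f
    unfolding pt_hull_subset_iff[OF convex_left_side]
    using matching_onD(1)[OF mM that] e j by (auto simp: pt_in_left_side subset_eq not_le)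
  moreover have "\<not> {i, j} \<subseteq> {..<2 * n} - {i..j}" using e(2) by auto
  ultimately have lft: "{f \<in> M - {{i, j}}. pt_hull n f \<subseteq> left_side (pt n i) (pt n j)} =
      {f \<in> M. f \<subseteq> {..<2 * n} - {i..j}}"
    by (intro Collect_cong) (metis Diff_iff singleton_iff)
  have "pt_hull n f \<subseteq> left_side (pt n j) (pt n i) \<longleftrightarrow> f \<subseteq> {..<2 * n} \<inter> {i<..<j}" if "f \<in> M" for f
    unfolding pt_hull_subset_iff[OF convex_left_side]
    using matching_onD(1)[OF mM that] e j by (auto simp: pt_in_left_side subset_eq not_le)
  moreover have "\<not> {i, j} \<subseteq> {..<2 * n} \<inter> {i<..<j}" by auto
  ultimately have rgt: "{f \<in> M - {{i, j}}. pt_hull n f \<subseteq> left_side (pt n j) (pt n i)} =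
      {f \<in> M. f \<subseteq> {..<2 * n} \<inter> {i<..<j}}"
    by (intro Collect_cong) (metis Diff_iff singleton_iff)
  have "Min {i, j} = i" "Max {i, j} = j" using e(2) by auto
  then show "2 * edge_length n M {i, j} = min (2 * n - 1 - (j - i)) (j - i - 1)"
    unfolding edge_length_def Let_def using lft rgt inn out by (simp add: nat_mult_min_right)
qed

section \<open>Edges seen from the center\<close>

definition diametral :: "nat \<Rightarrow> nat set \<Rightarrow> bool" where
  "diametral n e \<longleftrightarrow> Max e - Min e = n"

text \<open>The labels on the closed side of \<open>e\<close> that does not contain the center; for a diameter the
  choice of the side is arbitrary.\<close>

definition cap :: "nat \<Rightarrow> nat set \<Rightarrow> nat set" where
  "cap n e = (if Max e - Min e < n then {Min e..Max e} else {..<2 * n} - between e)"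

text \<open>The edges seen from the center: the diameter, if there is one, and the edges on the boundary of
  the regions that contain the center in their closure.\<close>

definition outer :: "nat \<Rightarrow> nat set set \<Rightarrow> nat set set" where
  "outer n M = {e \<in> M. \<forall>g\<in>M. g \<noteq> e \<and> \<not> diametral n g \<longrightarrow> \<not> e \<subseteq> cap n g}"

lemma diametral_insert: "i < j \<Longrightarrow> diametral n {i, j} \<longleftrightarrow> j - i = n"
  by (simp add: diametral_def)

lemma mem_cap_insert:
  assumes "i < j" "j < 2 * n"
  shows "x \<in> cap n {i, j} \<longleftrightarrow>
    (if j - i < n then i \<le> x \<and> x \<le> j else x < 2 * n \<and> (x \<le> i \<or> j \<le> x))"
  using assms by (auto simp: cap_def between_insert)

lemma matchings_edge:
  assumes "M \<in> matchings n" "e \<in> M"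
  obtains i j where "i < j" "j < 2 * n" "e = {i, j}"
proof -
  obtain i j where "i < j" "e = {i, j}" "i \<in> {..<2 * n}" "j \<in> {..<2 * n}"
    using matching_on_edge[OF matchings_matching[OF assms(1)] assms(2)] .
  then show thesis using that by auto
qed

section \<open>Caps and outer edges\<close>

lemma matchings_edge_pair:
  assumes M: "M \<in> matchings n" and ef: "e \<in> M" "f \<in> M" "e \<noteq> f"
  obtains i j k l where "i < j" "j < 2 * n" "e = {i, j}" "k < l" "l < 2 * n" "f = {k, l}"
    "j < k \<or> l < i \<or> i < k \<and> l < j \<or> k < i \<and> j < l"
proof -
  obtain i j where e: "i < j" "j < 2 * n" "e = {i, j}" using matchings_edge[OF M ef(1)] .
  obtain k l where f: "k < l" "l < 2 * n" "f = {k, l}" using matchings_edge[OF M ef(2)] .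
  have "f \<subseteq> {i<..<j} \<or> f \<subseteq> {..<2 * n} - {i..j}"
    using ncm_sides[of M "{..<2 * n}" i j f] M ef e by (auto simp: matchings_eq_ncm)
  then have "j < k \<or> l < i \<or> i < k \<and> l < j \<or> k < i \<and> j < l"
    using e f by auto
  then show thesis using that e f by blast
qed

lemma edge_subset_cap:
  assumes "M \<in> matchings n" "e \<in> M"
  shows "e \<subseteq> cap n e" "cap n e \<subseteq> {..<2 * n}"
proof -
  obtain i j where e: "i < j" "j < 2 * n" "e = {i, j}" using matchings_edge[OF assms] .
  then show "e \<subseteq> cap n e" "cap n e \<subseteq> {..<2 * n}" by (auto simp: mem_cap_insert split: if_splits)
qed

text \<open>The caps form a laminar family: two of them are disjoint or one contains the other. A
  contained cap also omits both endpoints of the larger edge, so containment is strict.\<close>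

lemma
  assumes M: "M \<in> matchings n" and ef: "e \<in> M" "f \<in> M" "e \<noteq> f"
  shows edge_inside_or_outside_cap: "f \<subseteq> cap n e \<or> f \<inter> cap n e = {}"
    and cap_mono: "f \<subseteq> cap n e \<Longrightarrow> cap n f \<subseteq> cap n e - e"
    and caps_laminar: "cap n e \<inter> cap n f \<noteq> {} \<Longrightarrow> f \<subseteq> cap n e \<or> e \<subseteq> cap n f"
proof -
  obtain i j k l where e: "i < j" "j < 2 * n" "e = {i, j}" and f: "k < l" "l < 2 * n" "f = {k, l}"
    and ord: "j < k \<or> l < i \<or> i < k \<and> l < j \<or> k < i \<and> j < l"
    using matchings_edge_pair[OF M ef] .
  show "f \<subseteq> cap n e \<or> f \<inter> cap n e = {}"
    using e f ord by (auto simp: mem_cap_insert split: if_splits)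
  show "cap n f \<subseteq> cap n e - e" if "f \<subseteq> cap n e"
  proof
    fix x assume "x \<in> cap n f"
    then show "x \<in> cap n e - e"
      using that e(1,2) f(1,2) ord unfolding e(3) f(3)
      by (simp add: mem_cap_insert split: if_splits) linarith+
  qed
  show "f \<subseteq> cap n e \<or> e \<subseteq> cap n f" if "cap n e \<inter> cap n f \<noteq> {}"
  proof -
    obtain x where "x \<in> cap n e" "x \<in> cap n f" using \<open>cap n e \<inter> cap n f \<noteq> {}\<close> by blast
    then show ?thesis
      using e(1,2) f(1,2) ord unfolding e(3) f(3)
      by (simp add: mem_cap_insert split: if_splits) linarith+
  qed
qed

lemma zero_notin_pt_hull_cap:
  assumes M: "M \<in> matchings n" and g: "g \<in> M" "\<not> diametral n g" and S: "S \<subseteq> cap n g"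
  shows "0 \<notin> pt_hull n S"
proof -
  obtain i j where ij: "i < j" "j < 2 * n" "g = {i, j}" using matchings_edge[OF M g(1)] .
  have S2: "S \<subseteq> {..<2 * n}" using S edge_subset_cap(2)[OF M g(1)] by blast
  show ?thesis
  proof (rule zero_notin_pt_hull[OF ij(1,2) S2])
    show "j - i < n \<and> S \<subseteq> {i..j} \<or> n < j - i \<and> S \<inter> {i<..<j} = {}"
      using S g(2) ij by (auto simp: diametral_insert cap_def between_insert split: if_splits)
  qed
qed

lemma finite_matching: "M \<in> matchings n \<Longrightarrow> finite M"
  using matching_on_finite[OF matchings_matching] by simp

text \<open>Take a largest cap containing \<open>x\<close> among those of the edges that are no
  diameters. An edge hiding the chosen one would have a strictly larger cap, again containing
  \<open>x\<close>.\<close>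

lemma outer_cover:
  assumes M: "M \<in> matchings n" and e0: "e0 \<in> M" "\<not> diametral n e0" "x \<in> e0"
  obtains e where "e \<in> outer n M" "\<not> diametral n e" "x \<in> cap n e"
proof -
  define C where "C = {e \<in> M. \<not> diametral n e \<and> x \<in> cap n e}"
  have "finite C" "e0 \<in> C"
    using finite_matching[OF M] e0 edge_subset_cap(1)[OF M e0(1)] by (auto simp: C_def)
  then have fin: "finite ((\<lambda>g. card (cap n g)) ` C)" "(\<lambda>g. card (cap n g)) ` C \<noteq> {}" by auto
  obtain e where e: "e \<in> C" "Max ((\<lambda>g. card (cap n g)) ` C) = card (cap n e)"
    using Max_in[OF fin] by blast
  have emax: "card (cap n g) \<le> card (cap n e)" if "g \<in> C" for g
    using Max_ge[OF fin(1), of "card (cap n g)"] that e(2) by simp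
  have "\<not> e \<subseteq> cap n g" if g: "g \<in> M" "g \<noteq> e" "\<not> diametral n g" for g
  proof
    assume "e \<subseteq> cap n g"
    then have sub: "cap n e \<subseteq> cap n g - g"
      using cap_mono[OF M g(1) _ g(2)] e(1) by (auto simp: C_def)
    have "g \<subseteq> cap n g" "g \<noteq> {}" "finite (cap n g)"
      using edge_subset_cap[OF M g(1)] matching_onD(2)[OF matchings_matching[OF M] g(1)] finite_subset by auto
    then have "cap n e \<subset> cap n g" using sub by blast
    then have "card (cap n e) < card (cap n g)"
      using \<open>finite (cap n g)\<close> by (rule psubset_card_mono[rotated])
    moreover have "g \<in> C" using g sub e(1) by (auto simp: C_def)
    ultimately show False using emax[of g] by simp
  qed
  then show thesis using that e(1) unfolding C_def outer_def by blast
qed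

lemma outer_disjoint:
  assumes M: "M \<in> matchings n" and "e \<in> outer n M" "f \<in> outer n M" "e \<noteq> f"
    and "\<not> diametral n e" "\<not> diametral n f"
  shows "cap n e \<inter> cap n f = {}"
  using caps_laminar[OF M, of e f] assms unfolding outer_def by blast

text \<open>Neither \<open>e\<close> nor \<open>f\<close> is hidden by another edge
  \<open>g\<close>, so both avoid the cap of \<open>g\<close> and lie on the same side of it; hence
  \<open>g\<close> misses their hull.\<close>

lemma outer_pair_empty:
  assumes M: "M \<in> matchings n" and ef: "e \<in> outer n M" "f \<in> outer n M" "e \<noteq> f"
    and nd: "\<And>g. g \<in> M \<Longrightarrow> g \<noteq> e \<Longrightarrow> g \<noteq> f \<Longrightarrow> \<not> diametral n g"
  shows "empty_quadrilateral n M e f"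
  unfolding empty_quadrilateral_def
proof (intro conjI ballI)
  note mM = matchings_matching[OF M]
  show eM: "e \<in> M" and fM: "f \<in> M" and "e \<noteq> f" using ef by (auto simp: outer_def)
  fix g assume "g \<in> M - {e, f}"
  then have g: "g \<in> M" "g \<noteq> e" "g \<noteq> f" by auto
  have "\<not> e \<subseteq> cap n g" "\<not> f \<subseteq> cap n g" using ef g nd[OF g] by (auto simp: outer_def)
  then have "e \<inter> cap n g = {}" "f \<inter> cap n g = {}"
    using edge_inside_or_outside_cap[OF M g(1)] eM fM g by metis+
  then have out: "(e \<union> f) \<inter> cap n g = {}" by blast
  have sub: "e \<union> f \<subseteq> {..<2 * n}" using matching_onD(1)[OF mM] eM fM by blast
  have "(e \<union> f) \<subseteq> between g \<or> (e \<union> f) \<inter> between g = {}"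
  proof (cases "Max g - Min g < n")
    case True
    then have "between g \<subseteq> cap n g" by (auto simp: cap_def between_def)
    then show ?thesis using out by blast
  next
    case False
    then show ?thesis using out sub by (auto simp: cap_def)
  qed
  moreover have "(e \<union> f) \<inter> g = {}"
    using matching_onD(3)[OF mM g(1)] eM fM g by blast
  ultimately show "pt_hull n g \<inter> pt_hull n (e \<union> f) = {}"
    using pt_hull_edge_disjoint_iff[OF matching_onD(2)[OF mM g(1)] matching_onD(1)[OF mM g(1)] sub] by blast
qed

text \<open>Suppose that \<open>g\<close> hides \<open>u\<close>. Either \<open>g\<close> is the
  partner \<open>v\<close>, or it misses the quadrilateral; in both cases \<open>v\<close> lies in
  the cap of \<open>g\<close> too. The whole quadrilateral is then cut off from the center.\<close>

lemma centered_pair_outer: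
  assumes M: "M \<in> matchings n" and E: "empty_quadrilateral n M e f" and z: "0 \<in> pt_hull n (e \<union> f)"
  shows "e \<in> outer n M" "f \<in> outer n M"
proof -
  note mM = matchings_matching[OF M]
  have main: "u \<in> outer n M" if E: "empty_quadrilateral n M u v" and z: "0 \<in> pt_hull n (u \<union> v)" for u v
  proof -
    have uv: "u \<in> M" "v \<in> M" "u \<noteq> v" using E by (auto simp: empty_quadrilateral_def)
    have "\<not> u \<subseteq> cap n g" if g: "g \<in> M" "g \<noteq> u" "\<not> diametral n g" for g
    proof
      assume u: "u \<subseteq> cap n g"
      have "v \<subseteq> cap n g"
      proof (cases "g = v")
        case True
        then show ?thesis using edge_subset_cap(1)[OF M g(1)] by simp
      next
        case False
        then have "pt_hull n g \<inter> pt_hull n (u \<union> v) = {}"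
          using E g unfolding empty_quadrilateral_def by blast
        moreover have sub: "u \<union> v \<subseteq> {..<2 * n}" using matching_onD(1)[OF mM] uv by blast
        moreover have disj: "(u \<union> v) \<inter> g = {}" using matching_onD(3)[OF mM g(1)] uv g False by blast
        ultimately have side: "u \<union> v \<subseteq> between g \<or> (u \<union> v) \<inter> between g = {}"
          using pt_hull_edge_disjoint_iff[OF matching_onD(2)[OF mM g(1)] matching_onD(1)[OF mM g(1)]] by blast
        obtain i j where ij: "i < j" "j < 2 * n" "g = {i, j}" using matchings_edge[OF M g(1)] .
        obtain x where x: "x \<in> u" "x \<in> cap n g" using matching_onD(2)[OF mM uv(1)] u
          by (metis card.empty equals0I subsetD zero_neq_numeral)
        show ?thesis
        proof (cases "j - i < n")
          case True
          then have "x \<in> between g" using x disj ij by (auto simp: cap_def between_insert le_less)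
          then have "v \<subseteq> between g" using side x by blast
          then show ?thesis using True ij by (auto simp: cap_def between_insert)
        next
          case False
          then have "x \<notin> between g" using x ij by (auto simp: cap_def between_insert)
          then show ?thesis using side x False ij sub by (auto simp: cap_def)
        qed
      qed
      then show False using zero_notin_pt_hull_cap[OF M g(1,3)] u z by blast
    qed
    then show ?thesis using uv(1) by (simp add: outer_def)
  qed
  show "e \<in> outer n M" using main[OF E z] .
  have "empty_quadrilateral n M f e" using E by (auto simp: empty_quadrilateral_def Un_commute)
  then show "f \<in> outer n M" using main[of f e] z by (simp add: Un_commute)
qed

text \<open>At most one of the two caps can wrap around, since a cap that does contains label 0. In
  each remaining case the labels \<open>x\<close> and \<open>x + n\<close> bound the gaps between
  the caps by \<open>n\<close> steps.\<close>

lemma antipodal_caps_zero: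
  assumes "i < j" "j < 2 * n" "k < l" "l < 2 * n" "j - i \<noteq> n" "l - k \<noteq> n"
    and "j < k \<or> l < i \<or> i < k \<and> l < j \<or> k < i \<and> j < l"
    and "cap n {i, j} \<inter> cap n {k, l} = {}" "x < n" "x \<in> cap n {i, j}" "x + n \<in> cap n {k, l}"
  shows "0 \<in> pt_hull n {i, j, k, l}"
proof -
  have "\<not> (j - i \<ge> n \<and> l - k \<ge> n)"
  proof
    assume "j - i \<ge> n \<and> l - k \<ge> n"
    then have "0 \<in> cap n {i, j}" "0 \<in> cap n {k, l}" using assms(1-4) by (auto simp: mem_cap_insert)
    then show False using assms(8) by blast
  qed
  then consider (ss) "j - i < n" "l - k < n" | (ls) "n \<le> j - i" "l - k < n" | (sl) "j - i < n" "n \<le> l - k"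
    by linarith
  then show ?thesis
  proof cases
    case ss
    then have "i \<le> x" "x \<le> j" "k \<le> x + n" "x + n \<le> l" using assms by (auto simp: mem_cap_insert)
    moreover have "j < k" using assms(1-4,7) ss calculation by linarith
    ultimately show ?thesis using ss assms(1-4) by (intro zero_in_pt_hull_quadrilateral) linarith+
  next
    case ls
    then have x: "x \<le> i \<or> j \<le> x" "k \<le> x + n" "x + n \<le> l"
      using assms(1-4,10,11) by (auto simp: mem_cap_insert)
    have "i < k" "l < j"
    proof -
      have "k \<in> cap n {k, l}" using assms(3,4) by (simp add: mem_cap_insert)
      then have "k \<notin> cap n {i, j}" using assms(8) by blast
      then have "i < k" "k < j" using ls assms(1-4) by (auto simp: mem_cap_insert)
      then show "i < k" "l < j" using assms(7) by linarith+
    qed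
    \<comment> \<open>The alternative \<open>j \<le> x\<close> would give
      \<open>x + n \<le> l < j \<le> x\<close>.\<close>
    moreover have "x \<le> i" using x calculation by linarith
    ultimately have "0 \<in> pt_hull n {i, k, l, j}"
      using ls assms(1-4,9) x by (intro zero_in_pt_hull_quadrilateral) linarith+
    then show ?thesis by (simp add: insert_commute)
  next
    case sl
    then have x: "i \<le> x" "x \<le> j" "x + n \<le> k \<or> l \<le> x + n"
      using assms(1-4,10,11) by (auto simp: mem_cap_insert)
    have "k < i" "j < l"
    proof -
      have "i \<in> cap n {i, j}" using assms(1,2) by (simp add: mem_cap_insert)
      then have "i \<notin> cap n {k, l}" using assms(8) by blast
      then have "k < i" "i < l" using sl assms(1-4) by (auto simp: mem_cap_insert)
      then show "k < i" "j < l" using assms(7) by linarith+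
    qed
    moreover have "l \<le> x + n" using x calculation sl assms(1-4) by linarith
    ultimately have "0 \<in> pt_hull n {k, i, j, l}"
      using sl assms(1-4,9) x by (intro zero_in_pt_hull_quadrilateral) linarith+
    then show ?thesis by (simp add: insert_commute)
  qed
qed

text \<open>The two edges differ because the cap of an edge that is no diameter spans fewer than
  \<open>n\<close> steps and so contains no antipodal pair.\<close>

lemma antipodal_pair_centered:
  assumes M: "M \<in> matchings n" and nd: "\<And>g. g \<in> M \<Longrightarrow> \<not> diametral n g"
    and ef: "e \<in> outer n M" "f \<in> outer n M" and x: "x < n" "x \<in> cap n e" "x + n \<in> cap n f"
  shows "e \<noteq> f" "{e, f} \<in> centered_pairs n M"
proof -
  have eM: "e \<in> M" "f \<in> M" using ef by (auto simp: outer_def)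
  show ne: "e \<noteq> f"
  proof
    assume "e = f"
    obtain i j where ij: "i < j" "j < 2 * n" "e = {i, j}" using matchings_edge[OF M eM(1)] .
    have "j - i \<noteq> n" using nd[OF eM(1)] ij by (simp add: diametral_insert)
    then show False using x \<open>e = f\<close> ij by (auto simp: mem_cap_insert split: if_splits)
  qed
  obtain i j k l where ijkl: "i < j" "j < 2 * n" "e = {i, j}" "k < l" "l < 2 * n" "f = {k, l}"
    "j < k \<or> l < i \<or> i < k \<and> l < j \<or> k < i \<and> j < l"
    using matchings_edge_pair[OF M eM ne] .
  have "0 \<in> pt_hull n {i, j, k, l}"
  proof (rule antipodal_caps_zero[OF ijkl(1,2,4,5) _ _ ijkl(7)])
    show "j - i \<noteq> n" "l - k \<noteq> n" using nd[OF eM(1)] nd[OF eM(2)] ijkl by (auto simp: diametral_insert)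
    show "cap n {i, j} \<inter> cap n {k, l} = {}"
      using outer_disjoint[OF M ef ne nd[OF eM(1)] nd[OF eM(2)]] ijkl by simp
  qed (use x ijkl in auto)
  moreover have "e \<union> f = {i, j, k, l}" using ijkl by auto
  ultimately show "{e, f} \<in> centered_pairs n M"
    using outer_pair_empty[OF M ef ne nd] by (intro centered_pairsI) auto
qed

text \<open>For two disjoint pairs, \<open>U\<close> takes one element of each; if they meet, a
  common element alone suffices.\<close>

lemma two_pairs_bipartite:
  assumes "finite P" "card P \<le> 2" "\<And>\<pi>. \<pi> \<in> P \<Longrightarrow> \<exists>u v. \<pi> = {u, v} \<and> u \<noteq> v"
  shows "\<exists>U. \<forall>\<pi>\<in>P. \<exists>u v. \<pi> = {u, v} \<and> u \<in> U \<and> v \<notin> U"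
proof -
  consider "card P = 0" | "card P = 1" | "card P = 2" using assms(2) by linarith
  then show ?thesis
  proof cases
    case 1
    then show ?thesis using assms(1) by simp
  next
    case 2
    then obtain \<pi> where P: "P = {\<pi>}" by (rule card_1_singletonE)
    then obtain u v where "\<pi> = {u, v}" "u \<noteq> v" using assms(3) by blast
    then show ?thesis unfolding P by (intro exI[of _ "{u}"]) auto
  next
    case 3
    then obtain \<pi> \<rho> where P: "P = {\<pi>, \<rho>}" "\<pi> \<noteq> \<rho>" unfolding card_2_iff by blast
    then obtain a b c d where ab: "\<pi> = {a, b}" "a \<noteq> b" and cd: "\<rho> = {c, d}" "c \<noteq> d"
      using assms(3) by (metis insertCI)
    show ?thesis
    proof (cases "\<pi> \<inter> \<rho> = {}")
      case True
      then have "a \<in> {a, c}" "b \<notin> {a, c}" "c \<in> {a, c}" "d \<notin> {a, c}" using ab cd by auto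
      then show ?thesis unfolding P(1) ab(1) cd(1) by (intro exI[of _ "{a, c}"]) blast
    next
      case False
      then obtain z where z: "z \<in> \<pi>" "z \<in> \<rho>" by blast
      have "\<exists>v. \<pi> = {z, v} \<and> v \<notin> {z}" using ab z(1) by (cases "z = a") (auto simp: insert_commute)
      moreover have "\<exists>v. \<rho> = {z, v} \<and> v \<notin> {z}" using cd z(2) by (cases "z = c") (auto simp: insert_commute)
      ultimately show ?thesis unfolding P(1) by (intro exI[of _ "{z}"]) blast
    qed
  qed
qed

lemma centered_pairsE:
  assumes "\<pi> \<in> centered_pairs n M"
  obtains e f where "\<pi> = {e, f}" "empty_quadrilateral n M e f" "0 \<in> pt_hull n (e \<union> f)"
  using assms unfolding centered_pairs_def by blast

lemma centered_pairs_subset: "\<pi> \<in> centered_pairs n M \<Longrightarrow> \<pi> \<subseteq> M"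
  by (auto simp: centered_pairs_def empty_quadrilateral_def)

lemma centered_pairs_distinct:
  "\<pi> \<in> centered_pairs n M \<Longrightarrow> \<exists>e f. \<pi> = {e, f} \<and> e \<noteq> f"
  unfolding centered_pairs_def empty_quadrilateral_def by blast

lemma finite_centered_pairs: "M \<in> matchings n \<Longrightarrow> finite (centered_pairs n M)"
  using finite_subset[of "centered_pairs n M" "Pow M"] finite_matching centered_pairs_subset by blast

text \<open>The labels of \<open>W\<close> from \<open>n\<close> on are the antipodes of those below
  \<open>n\<close> that \<open>W\<close> lacks.\<close>

lemma card_antipodal_transversal:
  assumes "W \<subseteq> {..<2 * n}" "\<And>x. x < n \<Longrightarrow> x + n \<in> W \<longleftrightarrow> x \<notin> W"
  shows "card W = n"
proof -
  have "W = (W \<inter> {..<n}) \<union> (\<lambda>x. x + n) ` ({..<n} - W)"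
  proof (intro equalityI subsetI)
    fix y assume y: "y \<in> W"
    show "y \<in> (W \<inter> {..<n}) \<union> (\<lambda>x. x + n) ` ({..<n} - W)"
    proof (cases "y < n")
      case False
      then have "y - n < n" "y = y - n + n" using assms(1) y by auto
      then have "y - n \<in> {..<n} - W" using assms(2)[of "y - n"] y by auto
      then show ?thesis using \<open>y = y - n + n\<close> by blast
    qed (use y in auto)
  qed (use assms(2) in auto)
  then have "card W = card (W \<inter> {..<n}) + card ((\<lambda>x. x + n) ` ({..<n} - W))"
    by (metis (no_types, lifting) card_Un_disjoint disjoint_iff finite_Diff finite_Int finite_imageI
        finite_lessThan imageE IntE lessThan_iff not_add_less2)
  also have "\<dots> = card ({..<n} \<inter> W) + card ({..<n} - W)" by (simp add: card_image Int_commute)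
  also have "\<dots> = n" by (metis card_Int_Diff card_lessThan finite_lessThan)
  finally show ?thesis .
qed

lemma outer_cover_no_diameter:
  assumes M: "M \<in> matchings n" and nd: "\<And>g. g \<in> M \<Longrightarrow> \<not> diametral n g" and x: "x < 2 * n"
  obtains e where "e \<in> outer n M" "x \<in> cap n e"
proof -
  obtain e0 where e0: "e0 \<in> M" "x \<in> e0"
    using matching_on_cover[OF matchings_matching[OF M] lessThan_iff[THEN iffD2, OF x]] .
  show thesis by (rule outer_cover[OF M e0(1) nd[OF e0(1)] e0(2)], rule that)
qed

text \<open>If there are at most two centered flips, the graph of the pairs flipped on the outer edges is
  bipartite. A colour class covers exactly one label of each antipodal pair, so \<open>n\<close> labels in total,
  but it also covers an even number of labels, because no edge leaves it.\<close>

lemma centered_pairs_odd_no_diameter: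
  assumes M: "M \<in> matchings n" and "odd n" and nd: "\<And>g. g \<in> M \<Longrightarrow> \<not> diametral n g"
  shows "3 \<le> card (centered_pairs n M)"
proof (rule ccontr)
  assume "\<not> ?thesis"
  then have le: "card (centered_pairs n M) \<le> 2" by simp
  obtain U where U: "\<forall>\<pi>\<in>centered_pairs n M. \<exists>u v. \<pi> = {u, v} \<and> u \<in> U \<and> v \<notin> U"
    using two_pairs_bipartite[OF finite_centered_pairs[OF M] le centered_pairs_distinct] ..
  define W where "W = (\<Union>e\<in>outer n M \<inter> U. cap n e)"
  note mM = matchings_matching[OF M]
  have oM: "e \<in> M" if "e \<in> outer n M" for e using that by (simp add: outer_def)
  have Wsub: "W \<subseteq> {..<2 * n}" using edge_subset_cap(2)[OF M] oM unfolding W_def by blast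
  \<comment> \<open>Caps of different outer edges are disjoint, so each label inherits the colour of
    a single outer edge.\<close>
  have memW: "y \<in> W \<longleftrightarrow> e \<in> U" if e: "e \<in> outer n M" "y \<in> cap n e" for y e
  proof
    assume "y \<in> W"
    then obtain f where f: "f \<in> outer n M" "f \<in> U" "y \<in> cap n f" unfolding W_def by blast
    then have "e = f" using outer_disjoint[OF M e(1) f(1)] nd oM e f by blast
    then show "e \<in> U" using f by simp
  qed (use e in \<open>auto simp: W_def\<close>)
  have "card W = n"
  proof (rule card_antipodal_transversal[OF Wsub])
    fix x assume x: "x < n"
    obtain e where e: "e \<in> outer n M" "x \<in> cap n e"
      using outer_cover_no_diameter[OF M nd, of x] x by auto
    obtain f where f: "f \<in> outer n M" "x + n \<in> cap n f"
      using outer_cover_no_diameter[OF M nd, of "x + n"] x by auto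
    have "\<exists>u v. {e, f} = {u, v} \<and> u \<in> U \<and> v \<notin> U"
      by (rule bspec[OF U antipodal_pair_centered(2)[OF M nd e(1) f(1) x e(2) f(2)]])
    then obtain u v where "{e, f} = {u, v}" "u \<in> U" "v \<notin> U" by (elim exE conjE)
    then have "e \<in> U \<longleftrightarrow> f \<notin> U" by (auto simp: doubleton_eq_iff)
    then show "x + n \<in> W \<longleftrightarrow> x \<notin> W" using memW[OF e] memW[OF f] by blast
  qed
  moreover have "matching_on W {g \<in> M. g \<subseteq> W}"
  proof (rule matching_on_subset[OF mM Wsub])
    fix g assume g: "g \<in> M" "g \<inter> W \<noteq> {}"
    then obtain y e where y: "y \<in> g" "e \<in> outer n M" "e \<in> U" "y \<in> cap n e" unfolding W_def by blast
    have "g \<subseteq> cap n e"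
    proof (cases "g = e")
      case True then show ?thesis using edge_subset_cap(1)[OF M g(1)] by simp
    next
      case False
      then show ?thesis using edge_inside_or_outside_cap[OF M oM[OF y(2)] g(1)] y by blast
    qed
    then show "g \<subseteq> W" using y unfolding W_def by blast
  qed
  then have "even (card W)" using card_matching_on[of W] Wsub finite_subset by (metis dvd_triv_left finite_lessThan)
  ultimately show False using \<open>odd n\<close> by simp
qed

text \<open>For even \<open>n\<close>, the partner of the chord \<open>{a, a + n - 1}\<close>: together they cut off \<open>n\<close> labels each.\<close>

definition parallel_chord :: "nat \<Rightarrow> nat \<Rightarrow> nat set" where
  "parallel_chord n a = (if a = 0 then {n, 2 * n - 1} else {a - 1, a + n})"

section \<open>A single centered flip for even \<open>n\<close>\<close>

lemma even_no_diameter: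
  assumes M: "M \<in> matchings n" and "even n" and g: "g \<in> M"
  shows "\<not> diametral n g"
proof -
  obtain i j where ij: "i < j" "j < 2 * n" "g = {i, j}" using matchings_edge[OF M g] .
  then show ?thesis using edge_length_eq(1)[OF M, of i j] g \<open>even n\<close> by (auto simp: diametral_insert)
qed

text \<open>A cap without a diameter has at most \<open>n\<close> labels, so two disjoint caps
  covering everything have exactly \<open>n\<close> each. This determines both chords up to
  rotation; \<open>a\<close> is the first label of a cap that does not wrap around.\<close>

lemma caps_cover_cases:
  assumes ij: "i < j" "j < 2 * n" and kl: "k < l" "l < 2 * n" and n: "2 \<le> n"
    and nd: "j - i \<noteq> n" "l - k \<noteq> n"
    and disj: "cap n {i, j} \<inter> cap n {k, l} = {}" and cov: "{..<2 * n} \<subseteq> cap n {i, j} \<union> cap n {k, l}"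
  obtains a where "a < n" "{{i, j}, {k, l}} = {{a, a + n - 1}, parallel_chord n a}"
proof -
  note intro = that
  have D: "\<not> (x \<in> cap n {i, j} \<and> x \<in> cap n {k, l})" for x using disj by blast
  have C: "x \<in> cap n {i, j} \<or> x \<in> cap n {k, l}" if "x < 2 * n" for x using cov that by blast
  \<comment> \<open>One cap wraps around label 0: its long chord \<open>{p, q}\<close> encloses the
    short chord \<open>{r, s}\<close> directly.\<close>
  have mix: thesis if h: "p < q" "q < 2 * n" "r < s" "s < 2 * n" "n < q - p" "s - r < n"
    and eq: "{{i, j}, {k, l}} = {{r, s}, {p, q}}"
    and D: "\<And>x. \<not> (x \<in> cap n {p, q} \<and> x \<in> cap n {r, s})"
    and C: "\<And>x. x < 2 * n \<Longrightarrow> x \<in> cap n {p, q} \<or> x \<in> cap n {r, s}" for p q r s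
  proof -
    have "p < r" "s < q" using D[of r] D[of s] h by (auto simp: mem_cap_insert)
    moreover have "p + 1 < 2 * n" "q - 1 < 2 * n" using h by linarith+
    then have "r \<le> p + 1" "q \<le> s + 1"
      using C[of "p + 1"] C[of "q - 1"] h calculation by (auto simp: mem_cap_insert)
    ultimately have "r = p + 1" "q = s + 1" "s = r + n - 1" using h by linarith+
    then have "{r, s} = {r, r + n - 1}" "{p, q} = parallel_chord n r" "r < n"
      using h n by (auto simp: parallel_chord_def)
    then show ?thesis using intro[of r] eq by simp
  qed
  \<comment> \<open>If neither cap wraps around, the caps must be the intervals from 0 to
    \<open>n - 1\<close> and from \<open>n\<close> to \<open>2 * n - 1\<close>.\<close>
  have both: thesis if h: "p < q" "q < 2 * n" "r < s" "s < 2 * n" "q - p < n" "s - r < n" "p \<le> r"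
    and eq: "{{i, j}, {k, l}} = {{p, q}, {r, s}}"
    and D: "\<And>x. \<not> (x \<in> cap n {p, q} \<and> x \<in> cap n {r, s})"
    and C: "\<And>x. x < 2 * n \<Longrightarrow> x \<in> cap n {p, q} \<or> x \<in> cap n {r, s}" for p q r s
  proof -
    have "q < r" using D[of r] h by (auto simp: mem_cap_insert)
    moreover have "p = 0" "s = 2 * n - 1" using C[of 0] C[of "2 * n - 1"] h calculation by (auto simp: mem_cap_insert)
    moreover have "r \<le> q + 1" using C[of "q + 1"] h calculation by (auto simp: mem_cap_insert)
    ultimately have "p = 0" "q = 0 + n - 1" "r = n" "s = 2 * n - 1" using h by linarith+
    then have "{p, q} = {0, 0 + n - 1}" "{r, s} = parallel_chord n 0" by (auto simp: parallel_chord_def)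
    then show ?thesis using intro[of 0] eq n by simp
  qed
  have "\<not> (n \<le> j - i \<and> n \<le> l - k)" using D[of 0] ij kl by (auto simp: mem_cap_insert)
  then consider "n < j - i" "l - k < n" | "n < l - k" "j - i < n" | "j - i < n" "l - k < n" "i \<le> k"
    | "j - i < n" "l - k < n" "k \<le> i" using nd by linarith
  then show thesis
  proof cases
    case 1 show ?thesis by (rule mix[of i j k l]) (use 1 ij kl C D in \<open>auto simp: insert_commute\<close>)
  next
    case 2 show ?thesis by (rule mix[of k l i j]) (use 2 ij kl C D in \<open>auto simp: insert_commute\<close>)
  next
    case 3 show ?thesis by (rule both[of i j k l]) (use 3 ij kl C D in auto)
  next
    case 4 show ?thesis by (rule both[of k l i j]) (use 4 ij kl C D in \<open>auto simp: insert_commute\<close>)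
  qed
qed

lemma cap_parallel_chords:
  assumes "a < n" "2 \<le> n"
  shows "{..<2 * n} \<subseteq> cap n {a, a + n - 1} \<union> cap n (parallel_chord n a)"
proof
  fix x assume "x \<in> {..<2 * n}"
  then show "x \<in> cap n {a, a + n - 1} \<union> cap n (parallel_chord n a)"
    using assms by (cases "a = 0") (auto simp: parallel_chord_def mem_cap_insert)
qed

lemma outer_subset_of_cover:
  assumes M: "M \<in> matchings n" and ef: "e \<in> M" "f \<in> M" "\<not> diametral n e" "\<not> diametral n f"
    and cov: "g \<in> M" "g \<subseteq> cap n e \<union> cap n f" "g \<in> outer n M"
  shows "g = e \<or> g = f"
proof (rule ccontr)
  assume ne: "\<not> ?thesis"
  have "g \<noteq> {}" using matching_onD(2)[OF matchings_matching[OF M] cov(1)] by auto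
  then have "g \<inter> cap n e \<noteq> {} \<or> g \<inter> cap n f \<noteq> {}" using cov(2) by blast
  then have "g \<subseteq> cap n e \<or> g \<subseteq> cap n f"
    using edge_inside_or_outside_cap[OF M ef(1) cov(1)] edge_inside_or_outside_cap[OF M ef(2) cov(1)] ne by metis
  then show False using cov(3) ef ne unfolding outer_def by blast
qed

text \<open>Every antipodal pair of labels yields a centered pair. If there is only one, its two
  caps contain all labels. Conversely, two caps containing all labels hide every third edge, which
  leaves a single candidate pair.\<close>

lemma centered_pairs_even:
  assumes M: "M \<in> matchings n" and "even n" "2 \<le> n"
  shows "1 \<le> card (centered_pairs n M)"
    and "card (centered_pairs n M) = 1 \<longleftrightarrow> (\<exists>a<n. {a, a + n - 1} \<in> M \<and> parallel_chord n a \<in> M)"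
proof -
  note nd = even_no_diameter[OF M \<open>even n\<close>]
  note mM = matchings_matching[OF M]
  have cov: "\<exists>e f. e \<in> outer n M \<and> f \<in> outer n M \<and> x \<in> cap n e \<and> x + n \<in> cap n f \<and> {e, f} \<in> centered_pairs n M"
    if x: "x < n" for x
  proof -
    obtain e where e: "e \<in> outer n M" "x \<in> cap n e"
      using outer_cover_no_diameter[OF M nd, of x] x by auto
    obtain f where f: "f \<in> outer n M" "x + n \<in> cap n f"
      using outer_cover_no_diameter[OF M nd, of "x + n"] x by auto
    show ?thesis
      using antipodal_pair_centered(2)[OF M nd e(1) f(1) x e(2) f(2)] e f by (intro exI conjI)
  qed
  have "centered_pairs n M \<noteq> {}" using cov[of 0] assms(3) by auto
  then show ge1: "1 \<le> card (centered_pairs n M)"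
    using finite_centered_pairs[OF M] by (simp add: Suc_le_eq card_gt_0_iff)
  show "card (centered_pairs n M) = 1 \<longleftrightarrow> (\<exists>a<n. {a, a + n - 1} \<in> M \<and> parallel_chord n a \<in> M)"
  proof
    assume "card (centered_pairs n M) = 1"
    then obtain \<pi> where \<pi>: "centered_pairs n M = {\<pi>}" by (rule card_1_singletonE)
    then have "\<pi> \<in> centered_pairs n M" by simp
    then obtain e f where ef: "\<pi> = {e, f}" "empty_quadrilateral n M e f" "0 \<in> pt_hull n (e \<union> f)"
      by (rule centered_pairsE)
    have eM: "e \<in> M" "f \<in> M" "e \<noteq> f" using ef(2) by (auto simp: empty_quadrilateral_def)
    have out: "e \<in> outer n M" "f \<in> outer n M" using centered_pair_outer[OF M ef(2,3)] .
    have "y \<in> cap n e \<union> cap n f" if "y < 2 * n" for y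
    proof (cases "y < n")
      case True
      then obtain u v where "y \<in> cap n u" "{u, v} \<in> centered_pairs n M" using cov by blast
      then show ?thesis using \<pi> ef(1) by (auto simp: doubleton_eq_iff)
    next
      case False
      then obtain x where x: "x < n" "y = x + n" using \<open>y < 2 * n\<close> by (metis add.commute le_Suc_ex mult_2 nat_add_left_cancel_less not_less)
      then obtain u v where "y \<in> cap n v" "{u, v} \<in> centered_pairs n M" using cov by blast
      then show ?thesis using \<pi> ef(1) by (auto simp: doubleton_eq_iff)
    qed
    then have cover: "{..<2 * n} \<subseteq> cap n e \<union> cap n f" by auto
    obtain i j where ij: "i < j" "j < 2 * n" "e = {i, j}" using matchings_edge[OF M eM(1)] .
    obtain k l where kl: "k < l" "l < 2 * n" "f = {k, l}" using matchings_edge[OF M eM(2)] .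
    have "j - i \<noteq> n" "l - k \<noteq> n" using nd[OF eM(1)] nd[OF eM(2)] ij kl by (auto simp: diametral_insert)
    then obtain a where "a < n" "{{i, j}, {k, l}} = {{a, a + n - 1}, parallel_chord n a}"
      using caps_cover_cases[OF ij(1,2) kl(1,2) assms(3)] cover outer_disjoint[OF M out eM(3) nd[OF eM(1)] nd[OF eM(2)]]
      unfolding ij(3) kl(3) by blast
    then show "\<exists>a<n. {a, a + n - 1} \<in> M \<and> parallel_chord n a \<in> M"
      using eM ij kl by (metis doubleton_eq_iff)
  next
    assume "\<exists>a<n. {a, a + n - 1} \<in> M \<and> parallel_chord n a \<in> M"
    then obtain a where a: "a < n" "{a, a + n - 1} \<in> M" "parallel_chord n a \<in> M" by blast
    have two: "g = {a, a + n - 1} \<or> g = parallel_chord n a" if "g \<in> outer n M" for g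
    proof -
      have g: "g \<in> M" using that by (simp add: outer_def)
      have "g \<subseteq> cap n {a, a + n - 1} \<union> cap n (parallel_chord n a)"
        using cap_parallel_chords[OF a(1) assms(3)] matching_onD(1)[OF mM g] by blast
      then show ?thesis using outer_subset_of_cover[OF M a(2,3) nd[OF a(2)] nd[OF a(3)] g _ that] by blast
    qed
    have "centered_pairs n M \<subseteq> {{{a, a + n - 1}, parallel_chord n a}}"
    proof
      fix \<pi> assume "\<pi> \<in> centered_pairs n M"
      then obtain e f where ef: "\<pi> = {e, f}" "empty_quadrilateral n M e f" "0 \<in> pt_hull n (e \<union> f)"
        by (rule centered_pairsE)
      have "e \<noteq> f" using ef(2) by (auto simp: empty_quadrilateral_def)
      then have "\<pi> = {{a, a + n - 1}, parallel_chord n a}"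
        using two[OF centered_pair_outer(1)[OF M ef(2,3)]] two[OF centered_pair_outer(2)[OF M ef(2,3)]] ef(1)
        by (metis insert_commute)
      then show "\<pi> \<in> {{{a, a + n - 1}, parallel_chord n a}}" by simp
    qed
    then have "card (centered_pairs n M) \<le> card {{{a, a + n - 1}, parallel_chord n a}}"
      by (intro card_mono) auto
    then show "card (centered_pairs n M) = 1" using ge1 by simp
  qed
qed

text \<open>For odd \<open>n\<close>, the chord joining the two outermost labels on the side of the diameter
  \<open>{p, p + n}\<close> that does not contain \<open>p + 1\<close>.\<close>

definition far_chord :: "nat \<Rightarrow> nat \<Rightarrow> nat set" where
  "far_chord n p = (if p = 0 then {n + 1, 2 * n - 1} else if p = n - 1 then {0, n - 2} else {p - 1, p + n + 1})"

lemma cap_far_chord: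
  assumes "p < n" "3 \<le> n"
  shows "cap n (far_chord n p) = {..<2 * n} - {p..p + n}" "\<not> diametral n (far_chord n p)"
    "far_chord n p \<subseteq> {..<2 * n} - {p..p + n}" "card (far_chord n p) = 2"
proof -
  \<comment> \<open>The far side of the diameter is an interval exactly in the first two cases;
    otherwise it wraps around label 0.\<close>
  consider "p = 0" | "p = n - 1" "p \<noteq> 0" | "0 < p" "p < n - 1" using assms by linarith
  then have *: "cap n (far_chord n p) = {..<2 * n} - {p..p + n} \<and> \<not> diametral n (far_chord n p)
    \<and> far_chord n p \<subseteq> {..<2 * n} - {p..p + n} \<and> card (far_chord n p) = 2"
  proof cases
    case 1
    then have f: "far_chord n p = {n + 1, 2 * n - 1}" by (simp add: far_chord_def)
    show ?thesis unfolding f set_eq_iff using assms 1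
      by (auto simp: mem_cap_insert diametral_insert)
  next
    case 2
    then have f: "far_chord n p = {0, n - 2}" by (simp add: far_chord_def)
    show ?thesis unfolding f set_eq_iff using assms 2
      by (auto simp: mem_cap_insert diametral_insert)
  next
    case 3
    then have f: "far_chord n p = {p - 1, p + n + 1}" by (simp add: far_chord_def)
    have "p - 1 < p + n + 1" "p + n + 1 < 2 * n" "\<not> p + n + 1 - (p - 1) < n" using 3 by linarith+
    then show ?thesis unfolding f set_eq_iff using assms 3
      by (auto simp: mem_cap_insert diametral_insert)
  qed
  then show "cap n (far_chord n p) = {..<2 * n} - {p..p + n}" "\<not> diametral n (far_chord n p)"
    "far_chord n p \<subseteq> {..<2 * n} - {p..p + n}" "card (far_chord n p) = 2" by blast+
qed

text \<open>The chord joins the first and the last label of its cap. A wrapping cap contains 0 and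
  \<open>2 * n - 1\<close>, which an interval spanning fewer than \<open>n\<close> steps cannot, so
  the mixed cases are impossible.\<close>

lemma chord_eq_if_cap_eq:
  assumes "i < j" "j < 2 * n" "k < l" "l < 2 * n" "j - i \<noteq> n" "l - k \<noteq> n" "cap n {i, j} = cap n {k, l}"
  shows "{i, j} = {k, l}"
proof -
  have C: "x \<in> cap n {i, j} \<longleftrightarrow> x \<in> cap n {k, l}" for x using assms(7) by simp
  have m: "i \<in> cap n {k, l}" "j \<in> cap n {k, l}" "k \<in> cap n {i, j}" "l \<in> cap n {i, j}"
  proof -
    show "i \<in> cap n {k, l}" "j \<in> cap n {k, l}"
      unfolding assms(7)[symmetric] using assms(1,2) by (auto simp: mem_cap_insert)
    show "k \<in> cap n {i, j}" "l \<in> cap n {i, j}"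
      unfolding assms(7) using assms(3,4) by (auto simp: mem_cap_insert)
  qed
  consider "j - i < n" "l - k < n" | "n < j - i" "n < l - k" | "j - i < n" "n < l - k" | "n < j - i" "l - k < n"
    using assms(5,6) by linarith
  then show ?thesis
  proof cases
    case 1
    then have "i = k" "j = l" using m assms(1-4) by (auto simp: mem_cap_insert)
    then show ?thesis by simp
  next
    case 2
    then have "i \<le> k \<or> l \<le> i" "j \<le> k \<or> l \<le> j" "k \<le> i \<or> j \<le> k" "l \<le> i \<or> j \<le> l"
      using m assms(1-4) by (simp_all add: mem_cap_insert)
    then have "i = k" "j = l" using 2 assms(1-4) by linarith+
    then show ?thesis by simp
  next
    case 3
    then have "i = 0" "j = 2 * n - 1" using C[of 0] C[of "2 * n - 1"] assms(1-4) by (auto simp: mem_cap_insert)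
    then show ?thesis using 3 assms by linarith
  next
    case 4
    then have "k = 0" "l = 2 * n - 1" using C[of 0] C[of "2 * n - 1"] assms(1-4) by (auto simp: mem_cap_insert)
    then show ?thesis using 4 assms by linarith
  qed
qed

section \<open>Centered flips in the presence of a diameter\<close>

lemma diameter_edge:
  assumes M: "M \<in> matchings n" and d: "d \<in> M" "diametral n d"
  obtains p where "p < n" "d = {p, p + n}"
proof -
  obtain i j where ij: "i < j" "j < 2 * n" "d = {i, j}" using matchings_edge[OF M d(1)] .
  then have "j = i + n" "i < n" using d(2) by (auto simp: diametral_insert)
  then show thesis using that ij by blast
qed

lemma diameter_unique:
  assumes M: "M \<in> matchings n" and d: "d \<in> M" "diametral n d" "d' \<in> M" "diametral n d'"
  shows "d = d'"
proof (rule ccontr)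
  assume ne: "d \<noteq> d'"
  obtain i j k l where "i < j" "j < 2 * n" "d = {i, j}" "k < l" "l < 2 * n" "d' = {k, l}"
    "j < k \<or> l < i \<or> i < k \<and> l < j \<or> k < i \<and> j < l"
    using matchings_edge_pair[OF M d(1,3) ne] .
  then show False using d(2,4) by (auto simp: diametral_insert)
qed

lemma cap_beside_diameter:
  assumes M: "M \<in> matchings n" and d: "{p, p + n} \<in> M" and e: "e \<in> M" "e \<noteq> {p, p + n}"
  shows "cap n e \<subseteq> {p<..<p + n} \<or> cap n e \<subseteq> {..<2 * n} - {p..p + n}"
proof -
  obtain i j k l where *: "i < j" "j < 2 * n" "{p, p + n} = {i, j}" and e: "k < l" "l < 2 * n" "e = {k, l}"
    and ord: "j < k \<or> l < i \<or> i < k \<and> l < j \<or> k < i \<and> j < l"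
    using matchings_edge_pair[OF M d e(1)] e(2) by metis
  have "i = p" "j = p + n" using * by (auto simp: doubleton_eq_iff)
  then show ?thesis using *(1,2) e ord by (auto simp: mem_cap_insert split: if_splits)
qed

text \<open>The diameter passes through the center, so it meets every quadrilateral containing the
  center and must itself be flipped. Conversely, its quadrilateral with any other outer edge is
  empty and contains the center.\<close>

lemma card_centered_pairs_diameter:
  assumes M: "M \<in> matchings n" and d: "{p, p + n} \<in> M" and n: "0 < n"
  shows "card (centered_pairs n M) = card (outer n M - {{p, p + n}})"
proof -
  define d where "d = {p, p + n}"
  have d: "d \<in> M" "diametral n d" using d n by (auto simp: d_def diametral_insert)
  have "p + n < 2 * n" using matching_onD(1)[OF matchings_matching[OF M] d(1)] by (auto simp: d_def)
  then have zd: "0 \<in> pt_hull n d" unfolding d_def using n by (subst zero_in_pt_hull_chord_iff) auto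
  have do: "d \<in> outer n M"
    unfolding outer_def
  proof (intro CollectI conjI ballI impI d(1))
    fix g assume g: "g \<in> M" "g \<noteq> d \<and> \<not> diametral n g"
    show "\<not> d \<subseteq> cap n g"
      using zero_notin_pt_hull_cap[OF M g(1)] g(2) zd by blast
  qed
  have eq: "centered_pairs n M = (\<lambda>e. {d, e}) ` (outer n M - {d})"
  proof (intro equalityI subsetI)
    fix \<pi> assume "\<pi> \<in> centered_pairs n M"
    then obtain e f where ef: "\<pi> = {e, f}" "empty_quadrilateral n M e f" "0 \<in> pt_hull n (e \<union> f)"
      by (rule centered_pairsE)
    have out: "e \<in> outer n M" "f \<in> outer n M" using centered_pair_outer[OF M ef(2,3)] .
    have "e \<noteq> f" using ef(2) by (auto simp: empty_quadrilateral_def)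
    have "d = e \<or> d = f"
    proof (rule ccontr)
      assume "\<not> ?thesis"
      then have "pt_hull n d \<inter> pt_hull n (e \<union> f) = {}"
        using ef(2) d(1) unfolding empty_quadrilateral_def by blast
      then show False using zd ef(3) by blast
    qed
    then show "\<pi> \<in> (\<lambda>e. {d, e}) ` (outer n M - {d})"
    proof
      assume "d = e"
      then show ?thesis using ef(1) out \<open>e \<noteq> f\<close> by blast
    next
      assume "d = f"
      then have "\<pi> = {d, e}" "e \<in> outer n M - {d}" using ef(1) out \<open>e \<noteq> f\<close> by auto
      then show ?thesis by blast
    qed
  next
    fix \<pi> assume "\<pi> \<in> (\<lambda>e. {d, e}) ` (outer n M - {d})"
    then obtain e where e: "\<pi> = {d, e}" "e \<in> outer n M" "e \<noteq> d" by blast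
    have "empty_quadrilateral n M d e"
      using diameter_unique[OF M d] e(3) by (intro outer_pair_empty[OF M do e(2)]) blast+
    moreover have "0 \<in> pt_hull n (d \<union> e)" using zd pt_hull_mono[of d "d \<union> e" n] by blast
    ultimately show "\<pi> \<in> centered_pairs n M" using e(1) centered_pairsI by simp
  qed
  have "inj_on (\<lambda>e. {d, e}) (outer n M - {d})"
    by (rule inj_onI) (metis doubleton_eq_iff)
  then show "card (centered_pairs n M) = card (outer n M - {{p, p + n}})"
    unfolding eq d_def[symmetric] by (rule card_image)
qed

text \<open>Labels on both sides of the diameter need to be covered by caps, and no cap reaches
  across, so each side contributes an outer edge. With one per side, its cap is the entire side,
  which forces its endpoints to be the extreme labels there.\<close>

lemma centered_pairs_odd_diameter:
  assumes M: "M \<in> matchings n" and d: "{p, p + n} \<in> M" and n: "3 \<le> n"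
  shows "2 \<le> card (centered_pairs n M)"
    and "card (centered_pairs n M) = 2 \<longleftrightarrow> {p + 1, p + n - 1} \<in> M \<and> far_chord n p \<in> M"
proof -
  note mM = matchings_matching[OF M]
  have p: "p < n" using matching_onD(1)[OF mM d] by auto
  have dd: "diametral n {p, p + n}" using n by (simp add: diametral_insert)
  define T where "T = outer n M - {{p, p + n}}"
  have cT: "card (centered_pairs n M) = card T"
    unfolding T_def using n by (intro card_centered_pairs_diameter[OF M d]) simp
  have TM: "e \<in> M" "e \<noteq> {p, p + n}" "\<not> diametral n e" if "e \<in> T" for e
    using that diameter_unique[OF M d dd, of e] by (auto simp: T_def outer_def)
  have finT: "finite T" using finite_subset[OF _ finite_matching[OF M], of T] TM(1) by blast
  have cov: "\<exists>e\<in>T. x \<in> cap n e" if x: "x < 2 * n" "x \<noteq> p" "x \<noteq> p + n" for x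
  proof -
    obtain e0 where e0: "e0 \<in> M" "x \<in> e0"
      using matching_on_cover[OF mM lessThan_iff[THEN iffD2, OF x(1)]] .
    have "e0 \<noteq> {p, p + n}" using e0 x by auto
    then have "\<not> diametral n e0" using diameter_unique[OF M d dd e0(1)] by blast
    then obtain e where e: "e \<in> outer n M" "\<not> diametral n e" "x \<in> cap n e"
      using outer_cover[OF M e0(1) _ e0(2)] by metis
    then have "e \<in> T" using dd by (auto simp: T_def)
    then show ?thesis using e(3) by blast
  qed
  have side: "cap n e \<subseteq> {p<..<p + n} \<or> cap n e \<subseteq> {..<2 * n} - {p..p + n}" if "e \<in> T" for e
    using cap_beside_diameter[OF M d TM(1,2)[OF that]] .
  \<comment> \<open>The cyclic predecessor of \<open>p\<close>; it lies on the other side of the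
    diameter than \<open>p + 1\<close>.\<close>
  define y where "y = (if p = 0 then 2 * n - 1 else p - 1)"
  have y: "y \<in> {..<2 * n} - {p..p + n}" using p n by (auto simp: y_def)
  obtain e1 where e1: "e1 \<in> T" "p + 1 \<in> cap n e1" using cov[of "p + 1"] p n by auto
  obtain e2 where e2: "e2 \<in> T" "y \<in> cap n e2" using cov[of y] y by auto
  have s1: "cap n e1 \<subseteq> {p<..<p + n}" using side[OF e1(1)] e1(2) by auto
  have s2: "cap n e2 \<subseteq> {..<2 * n} - {p..p + n}" using side[OF e2(1)] e2(2) y by auto
  have ne: "e1 \<noteq> e2" using s1 s2 e1(2) by auto
  then have "card {e1, e2} = 2" by simp
  moreover have "{e1, e2} \<subseteq> T" using e1 e2 by blast
  ultimately show ge2: "2 \<le> card (centered_pairs n M)" unfolding cT using card_mono[OF finT] by metis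
  show "card (centered_pairs n M) = 2 \<longleftrightarrow> {p + 1, p + n - 1} \<in> M \<and> far_chord n p \<in> M"
  proof
    assume "card (centered_pairs n M) = 2"
    then have T: "T = {e1, e2}"
      using card_subset_eq[OF finT \<open>{e1, e2} \<subseteq> T\<close>] \<open>card {e1, e2} = 2\<close> cT by simp
    have in1: "x \<in> cap n e1" if "p < x" "x < p + n" for x
      using cov[of x] that p s2 T by auto
    have in2: "x \<in> cap n e2" if "x \<in> {..<2 * n} - {p..p + n}" for x
      using cov[of x] that s1 T by auto
    obtain i j where ij: "i < j" "j < 2 * n" "e1 = {i, j}" using matchings_edge[OF M TM(1)[OF e1(1)]] .
    have "cap n {i, j} = {p<..<p + n}" using in1 s1 ij(3) by auto
    also have "\<dots> = cap n {p + 1, p + n - 1}" unfolding set_eq_iff using p n by (auto simp: mem_cap_insert)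
    finally have "{i, j} = {p + 1, p + n - 1}"
      using ij p n TM(3)[OF e1(1)] by (intro chord_eq_if_cap_eq[where n = n]) (auto simp: diametral_insert)
    then have near: "{p + 1, p + n - 1} \<in> M" using TM(1)[OF e1(1)] ij(3) by simp
    obtain k l where kl: "k < l" "l < 2 * n" "e2 = {k, l}" using matchings_edge[OF M TM(1)[OF e2(1)]] .
    obtain u v where uv: "u < v" "far_chord n p = {u, v}"
      using card_2_ordered[OF cap_far_chord(4)[OF p n]] .
    have "cap n {k, l} = {..<2 * n} - {p..p + n}" using in2 s2 kl(3) by auto
    then have "cap n {k, l} = cap n {u, v}" using cap_far_chord(1)[OF p n] uv(2) by simp
    moreover have "v < 2 * n" using cap_far_chord(3)[OF p n] uv by auto
    ultimately have "{k, l} = {u, v}"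
      using kl uv TM(3)[OF e2(1)] cap_far_chord(2)[OF p n]
      by (intro chord_eq_if_cap_eq[where n = n]) (auto simp: diametral_insert)
    then have "far_chord n p \<in> M" using TM(1)[OF e2(1)] kl(3) uv(2) by simp
    with near show "{p + 1, p + n - 1} \<in> M \<and> far_chord n p \<in> M" by blast
  next
    assume f: "{p + 1, p + n - 1} \<in> M \<and> far_chord n p \<in> M"
    have nd: "\<not> diametral n {p + 1, p + n - 1}" using n by (simp add: diametral_insert)
    have c1: "cap n {p + 1, p + n - 1} = {p<..<p + n}"
      unfolding set_eq_iff using p n by (auto simp: mem_cap_insert)
    have "T \<subseteq> {{p + 1, p + n - 1}, far_chord n p}"
    proof
      fix g assume g: "g \<in> T"
      have "g \<subseteq> cap n {p + 1, p + n - 1} \<union> cap n (far_chord n p)"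
        unfolding c1 cap_far_chord(1)[OF p n] using side[OF g] edge_subset_cap(1)[OF M TM(1)[OF g]] by blast
      moreover have "g \<in> outer n M" using g by (simp add: T_def)
      ultimately have "g = {p + 1, p + n - 1} \<or> g = far_chord n p"
        using f by (intro outer_subset_of_cover[OF M _ _ nd cap_far_chord(2)[OF p n] TM(1)[OF g]]) auto
      then show "g \<in> {{p + 1, p + n - 1}, far_chord n p}" by simp
    qed
    then have "card T \<le> card {{p + 1, p + n - 1}, far_chord n p}" by (intro card_mono) auto
    also have "\<dots> \<le> 2" by (simp add: card_insert_if)
    finally show "card (centered_pairs n M) = 2" using ge2 cT by simp
  qed
qed

section \<open>Edge lengths\<close>

lemma two_mu:
  shows "even n \<Longrightarrow> 2 \<le> n \<Longrightarrow> 2 * mu n = n - 2"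
    and "odd n \<Longrightarrow> 2 * mu n = n - 1"
proof -
  assume "even n" "2 \<le> n"
  then obtain m where m: "n = 2 * m" by blast
  then have "(real n - 2) / 2 = of_int (int m - 1)" by simp
  then have "mu n = nat (int m - 1)" unfolding mu_def by (simp only: ceiling_of_int)
  then show "2 * mu n = n - 2" using m by simp
next
  assume "odd n"
  then obtain m where m: "n = 2 * m + 1" by (rule oddE)
  then have "\<lceil>(real n - 2) / 2\<rceil> = int m" by (simp add: ceiling_eq_iff)
  then show "2 * mu n = n - 1" using m by (simp add: mu_def)
qed

text \<open>These are the edges whose shorter arc has \<open>n - 1\<close> steps. A half turn is
  ruled out because label differences along edges are odd.\<close>

lemma edge_length_eq_mu_even:
  assumes M: "M \<in> matchings n" and "even n" "2 \<le> n" and e: "{i, j} \<in> M" "i < j"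
  shows "edge_length n M {i, j} = mu n \<longleftrightarrow> j - i = n - 1 \<or> j - i = n + 1"
proof -
  have j: "j < 2 * n" using matching_onD(1)[OF matchings_matching[OF M] e(1)] by auto
  have "edge_length n M {i, j} = mu n \<longleftrightarrow> 2 * edge_length n M {i, j} = 2 * mu n" by simp
  also have "\<dots> \<longleftrightarrow> min (2 * n - 1 - (j - i)) (j - i - 1) = n - 2"
    using edge_length_eq(2)[OF M e] two_mu(1)[OF assms(2,3)] by simp
  also have "\<dots> \<longleftrightarrow> j - i = n - 1 \<or> j - i = n + 1"
    using edge_length_eq(1)[OF M e] assms(2,3) e(2) j by (auto simp: min_def)
  finally show ?thesis .
qed

text \<open>The shorter closed side of such an edge has \<open>n\<close> of the \<open>2 * n\<close>
  labels, so for two non-crossing ones there is no slack: in each relative position all endpoints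
  are determined.\<close>

lemma longest_pair_even:
  assumes M: "M \<in> matchings n" and n: "even n" "2 \<le> n" and ef: "e \<in> M" "f \<in> M" "e \<noteq> f"
    and len: "edge_length n M e = mu n" "edge_length n M f = mu n"
  obtains a where "a < n" "{e, f} = {{a, a + n - 1}, parallel_chord n a}"
proof -
  note intro = that
  obtain i j k l where e: "i < j" "j < 2 * n" "e = {i, j}" and f: "k < l" "l < 2 * n" "f = {k, l}"
    and ord: "j < k \<or> l < i \<or> i < k \<and> l < j \<or> k < i \<and> j < l"
    using matchings_edge_pair[OF M ef] .
  have d: "j - i = n - 1 \<or> j - i = n + 1" "l - k = n - 1 \<or> l - k = n + 1"
    using edge_length_eq_mu_even[OF M n] ef len e f by auto
  from ord show thesis
  proof (elim disjE conjE)
    assume "j < k"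
    then have "i = 0" "j = n - 1" "k = n" "l = 2 * n - 1" using d e f n by linarith+
    then show ?thesis using intro[of 0] e f n by (simp add: parallel_chord_def)
  next
    assume "l < i"
    then have "k = 0" "l = n - 1" "i = n" "j = 2 * n - 1" using d e f n by linarith+
    then show ?thesis using intro[of 0] e f n by (simp add: parallel_chord_def insert_commute)
  next
    assume "i < k" "l < j"
    then have *: "k = i + 1" "l = i + n" "j = i + n + 1" using d e f n by linarith+
    then have "k < n" using e by linarith
    moreover have "{k, l} = {k, k + n - 1}" "{i, j} = parallel_chord n k" using * by (auto simp: parallel_chord_def)
    ultimately show ?thesis using intro[of k] e(3) f(3) by (simp add: insert_commute)
  next
    assume "k < i" "j < l"
    then have *: "i = k + 1" "j = k + n" "l = k + n + 1" using d e f n by linarith+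
    then have "i < n" using f by linarith
    moreover have "{i, j} = {i, i + n - 1}" "{k, l} = parallel_chord n i" using * by (auto simp: parallel_chord_def)
    ultimately show ?thesis using intro[of i] e(3) f(3) by simp
  qed
qed

text \<open>The conjunct \<open>k = n\<close> keeps the chord apart from those of the form
  \<open>{a, a + n - 1}\<close> with \<open>a < n\<close>, which have the same difference
  \<open>n - 1\<close>.\<close>

lemma parallel_chord_ordered:
  assumes "a < n" "2 \<le> n"
  obtains k l where "k < l" "l < 2 * n" "parallel_chord n a = {k, l}" "l - k = n - 1 \<and> k = n \<or> l - k = n + 1"
proof (cases "a = 0")
  case True
  then show thesis using that[of n "2 * n - 1"] assms by (auto simp: parallel_chord_def)
next
  case False
  then show thesis using that[of "a - 1" "a + n"] assms by (auto simp: parallel_chord_def)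
qed

lemma two_longest_edges_even_iff:
  assumes M: "M \<in> matchings n" and n: "even n" "2 \<le> n"
  shows "card {e \<in> M. edge_length n M e = mu n} = 2 \<longleftrightarrow>
    (\<exists>a<n. {a, a + n - 1} \<in> M \<and> parallel_chord n a \<in> M)"
proof
  assume "card {e \<in> M. edge_length n M e = mu n} = 2"
  then obtain e f where L: "{e \<in> M. edge_length n M e = mu n} = {e, f}" "e \<noteq> f"
    unfolding card_2_iff by blast
  have ef: "e \<in> M" "f \<in> M" "edge_length n M e = mu n" "edge_length n M f = mu n"
    using L(1) by (metis (mono_tags, lifting) insertCI mem_Collect_eq)+
  obtain a where a: "a < n" "{e, f} = {{a, a + n - 1}, parallel_chord n a}"
    using longest_pair_even[OF M n ef(1,2) L(2) ef(3,4)] .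
  have "{a, a + n - 1} \<in> {e, f}" "parallel_chord n a \<in> {e, f}" unfolding a(2) by auto
  then show "\<exists>a<n. {a, a + n - 1} \<in> M \<and> parallel_chord n a \<in> M" using a(1) ef(1,2) by auto
next
  assume "\<exists>a<n. {a, a + n - 1} \<in> M \<and> parallel_chord n a \<in> M"
  then obtain a where a: "a < n" "{a, a + n - 1} \<in> M" "parallel_chord n a \<in> M" by blast
  obtain k l where kl: "k < l" "l < 2 * n" "parallel_chord n a = {k, l}" "l - k = n - 1 \<and> k = n \<or> l - k = n + 1"
    using parallel_chord_ordered[OF a(1) n(2)] .
  have ne: "{a, a + n - 1} \<noteq> parallel_chord n a"
    using kl a(1) n by (auto simp: doubleton_eq_iff)
  have len: "edge_length n M {a, a + n - 1} = mu n" "edge_length n M (parallel_chord n a) = mu n"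
    using edge_length_eq_mu_even[OF M n] a kl n by auto
  \<comment> \<open>Any further longest edge forms a pair of the same shape with
    \<open>{a, a + n - 1}\<close>; comparing the two descriptions gives
    \<open>b = a\<close>.\<close>
  have "g = parallel_chord n a" if g: "g \<in> M" "edge_length n M g = mu n" "g \<noteq> {a, a + n - 1}" for g
  proof -
    obtain b where b: "b < n" "{{a, a + n - 1}, g} = {{b, b + n - 1}, parallel_chord n b}"
      using longest_pair_even[OF M n a(2) g(1) _ len(1) g(2)] g(3) by metis
    obtain u v where uv: "u < v" "v < 2 * n" "parallel_chord n b = {u, v}" "v - u = n - 1 \<and> u = n \<or> v - u = n + 1"
      using parallel_chord_ordered[OF b(1) n(2)] .
    have "{a, a + n - 1} \<noteq> parallel_chord n b"
      using uv a(1) n by (auto simp: doubleton_eq_iff)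
    then have "{a, a + n - 1} = {b, b + n - 1}" "g = parallel_chord n b"
      using b(2) unfolding doubleton_eq_iff[of "{a, a + n - 1}"] by auto
    moreover then have "a = b" using n by (auto simp: doubleton_eq_iff)
    ultimately show ?thesis by simp
  qed
  then have "{e \<in> M. edge_length n M e = mu n} = {{a, a + n - 1}, parallel_chord n a}"
    using a(2,3) len by blast
  then show "card {e \<in> M. edge_length n M e = mu n} = 2" using ne by simp
qed

text \<open>For odd \<open>n\<close> a half turn has the right parity and attains the maximum. By
  parity the next possible arc is shorter by two steps.\<close>

lemma edge_length_odd:
  assumes M: "M \<in> matchings n" and "odd n" "3 \<le> n" and e: "{i, j} \<in> M" "i < j"
  shows "edge_length n M {i, j} = mu n \<longleftrightarrow> j - i = n"
    and "edge_length n M {i, j} = mu n - 1 \<longleftrightarrow> j - i = n - 2 \<or> j - i = n + 2"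
proof -
  have j: "j < 2 * n" using matching_onD(1)[OF matchings_matching[OF M] e(1)] by auto
  note l = edge_length_eq[OF M e]
  have "edge_length n M {i, j} = mu n \<longleftrightarrow> 2 * edge_length n M {i, j} = 2 * mu n" by simp
  also have "\<dots> \<longleftrightarrow> min (2 * n - 1 - (j - i)) (j - i - 1) = n - 1"
    using l(2) two_mu(2)[OF assms(2)] by simp
  also have "\<dots> \<longleftrightarrow> j - i = n" using e(2) j by (auto simp: min_def)
  finally show "edge_length n M {i, j} = mu n \<longleftrightarrow> j - i = n" .
  have "edge_length n M {i, j} = mu n - 1 \<longleftrightarrow> 2 * edge_length n M {i, j} = 2 * (mu n - 1)" by simp
  also have "\<dots> \<longleftrightarrow> min (2 * n - 1 - (j - i)) (j - i - 1) = n - 3"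
    unfolding l(2) diff_mult_distrib2 two_mu(2)[OF assms(2)] by (simp add: numeral_3_eq_3)
  also have "\<dots> \<longleftrightarrow> j - i = n - 2 \<or> j - i = n + 2"
    using l(1) assms(2,3) e(2) j by (auto simp: min_def)
  finally show "edge_length n M {i, j} = mu n - 1 \<longleftrightarrow> j - i = n - 2 \<or> j - i = n + 2" .
qed

lemma diameters_odd_eq:
  assumes M: "M \<in> matchings n" and n: "odd n" "3 \<le> n"
  shows "{e \<in> M. edge_length n M e = mu n \<and> 0 \<in> pt_hull n e} = {e \<in> M. diametral n e}"
proof -
  have "edge_length n M e = mu n \<and> 0 \<in> pt_hull n e \<longleftrightarrow> diametral n e" if e: "e \<in> M" for e
  proof -
    obtain i j where ij: "i < j" "j < 2 * n" "e = {i, j}" using matchings_edge[OF M e] .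
    show ?thesis using edge_length_odd(1)[OF M n, of i j] zero_in_pt_hull_chord_iff[OF ij(1,2)] ij e
      by (simp add: diametral_insert)
  qed
  then show ?thesis by blast
qed

lemma far_chord_ordered:
  assumes "p < n" "3 \<le> n"
  obtains k l where "k < l" "l < 2 * n" "far_chord n p = {k, l}" "l - k = n - 2 \<or> l - k = n + 2"
proof -
  consider "p = 0" | "p = n - 1" "p \<noteq> 0" | "0 < p" "p < n - 1" using assms by linarith
  then show thesis
  proof cases
    case 1
    then show ?thesis using that[of "n + 1" "2 * n - 1"] assms by (auto simp: far_chord_def)
  next
    case 2
    then show ?thesis using that[of 0 "n - 2"] assms by (auto simp: far_chord_def)
  next
    case 3
    then show ?thesis using that[of "p - 1" "p + n + 1"] assms by (auto simp: far_chord_def)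
  qed
qed

text \<open>The shorter closed side of an edge of length \<open>mu n - 1\<close> has
  \<open>n - 1\<close> labels, as many as lie strictly on one side of the diameter. Each side thus
  admits one candidate, the chord of its extreme labels.\<close>

lemma second_longest_edges_odd:
  assumes M: "M \<in> matchings n" and n: "odd n" "3 \<le> n" and d: "{p, p + n} \<in> M"
  shows "{e \<in> M. edge_length n M e = mu n - 1} = M \<inter> {{p + 1, p + n - 1}, far_chord n p}"
proof -
  have p: "p < n" using matching_onD(1)[OF matchings_matching[OF M] d] by auto
  have 1: "e = {p + 1, p + n - 1} \<or> e = far_chord n p"
    if e: "e \<in> M" "edge_length n M e = mu n - 1" for e
  proof -
    obtain i' j' where ij': "i' < j'" "e = {i', j'}" using matchings_edge[OF M e(1)] by metis
    then have "j' - i' = n - 2 \<or> j' - i' = n + 2" using edge_length_odd(2)[OF M n] e by blast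
    then have "e \<noteq> {p, p + n}" using ij' n by (auto simp: doubleton_eq_iff)
    then obtain i j k l where *: "i < j" "j < 2 * n" "{p, p + n} = {i, j}"
      and f: "k < l" "l < 2 * n" "e = {k, l}"
      and ord: "j < k \<or> l < i \<or> i < k \<and> l < j \<or> k < i \<and> j < l"
      using matchings_edge_pair[OF M d e(1)] by metis
    have ij: "i = p" "j = p + n" using * by (auto simp: doubleton_eq_iff)
    have diff: "l - k = n - 2 \<or> l - k = n + 2" using edge_length_odd(2)[OF M n, of k l] f e by blast
    from ord show ?thesis
    proof (elim disjE conjE)
      assume "j < k"
      then have "p = 0" "k = n + 1" "l = 2 * n - 1" using diff f n ij by linarith+
      then show ?thesis using f by (simp add: far_chord_def)
    next
      assume "l < i"
      then have "p = n - 1" "k = 0" "l = n - 2" using diff f n ij p by linarith+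
      then show ?thesis using f n by (simp add: far_chord_def)
    next
      assume "i < k" "l < j"
      then have "k = p + 1" "l = p + n - 1" using diff f n ij by linarith+
      then show ?thesis using f by simp
    next
      assume "k < i" "j < l"
      then have "0 < p" "p < n - 1" "k = p - 1" "l = p + n + 1" using diff f n ij by linarith+
      then show ?thesis using f by (simp add: far_chord_def)
    qed
  qed
  have 2: "edge_length n M {p + 1, p + n - 1} = mu n - 1" if "{p + 1, p + n - 1} \<in> M"
    using edge_length_odd(2)[OF M n that] n by simp
  have 3: "edge_length n M (far_chord n p) = mu n - 1" if f: "far_chord n p \<in> M"
  proof -
    obtain k l where "k < l" "far_chord n p = {k, l}" "l - k = n - 2 \<or> l - k = n + 2"
      using far_chord_ordered[OF p n(2)] by metis
    then show ?thesis using edge_length_odd(2)[OF M n, of k l] f by simp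
  qed
  show ?thesis
  proof (rule set_eqI)
    fix e
    show "e \<in> {e \<in> M. edge_length n M e = mu n - 1} \<longleftrightarrow> e \<in> M \<inter> {{p + 1, p + n - 1}, far_chord n p}"
      using 1[of e] 2 3 by auto
  qed
qed

lemma near_neq_far_chord:
  assumes "p < n" "3 \<le> n"
  shows "{p + 1, p + n - 1} \<noteq> far_chord n p"
proof
  assume "{p + 1, p + n - 1} = far_chord n p"
  then have "p + 1 \<in> far_chord n p" by blast
  then have "p + 1 \<in> {..<2 * n} - {p..p + n}" using cap_far_chord(3)[OF assms] by blast
  then show False using assms by simp
qed

lemma two_second_longest_edges_odd_iff:
  assumes M: "M \<in> matchings n" and n: "odd n" "3 \<le> n" and d: "{p, p + n} \<in> M"
  shows "card {e \<in> M. edge_length n M e = mu n - 1} = 2 \<longleftrightarrow>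
    {p + 1, p + n - 1} \<in> M \<and> far_chord n p \<in> M"
proof -
  have p: "p < n" using matching_onD(1)[OF matchings_matching[OF M] d] by auto
  have c: "card {{p + 1, p + n - 1}, far_chord n p} = 2" using near_neq_far_chord[OF p n(2)] by simp
  show ?thesis unfolding second_longest_edges_odd[OF M n d]
  proof
    assume "card (M \<inter> {{p + 1, p + n - 1}, far_chord n p}) = 2"
    then have "M \<inter> {{p + 1, p + n - 1}, far_chord n p} = {{p + 1, p + n - 1}, far_chord n p}"
      using c by (intro card_subset_eq) auto
    then show "{p + 1, p + n - 1} \<in> M \<and> far_chord n p \<in> M" by blast
  next
    assume "{p + 1, p + n - 1} \<in> M \<and> far_chord n p \<in> M"
    then have "M \<inter> {{p + 1, p + n - 1}, far_chord n p} = {{p + 1, p + n - 1}, far_chord n p}" by blast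
    then show "card (M \<inter> {{p + 1, p + n - 1}, far_chord n p}) = 2" using c by simp
  qed
qed

section \<open>Number of matchings of minimum degree\<close>

text \<open>All remaining \<open>2 * m\<close> labels lie on one side of the chord; the empty side
  contributes the factor 1.\<close>

lemma card_ncm_containing_chord:
  assumes S: "finite S" and kl: "k < l" "k \<in> S" "l \<in> S" and c: "card S = 2 * m + 2"
    and side: "S \<inter> {k<..<l} = {} \<or> S - {k..l} = {}"
  shows "real (card {M \<in> ncm S. {k, l} \<in> M}) = catalan m"
proof -
  have part: "card S = card (S \<inter> {k<..<l}) + card (S - {k..l}) + 2"
  proof -
    have "S = (S \<inter> {k<..<l}) \<union> (S - {k..l}) \<union> {k, l}" using kl by auto
    also have "card \<dots> = card ((S \<inter> {k<..<l}) \<union> (S - {k..l})) + card {k, l}"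
      using S by (intro card_Un_disjoint) (use kl in auto)
    also have "card ((S \<inter> {k<..<l}) \<union> (S - {k..l})) = card (S \<inter> {k<..<l}) + card (S - {k..l})"
      using S by (intro card_Un_disjoint) auto
    finally show ?thesis using kl by simp
  qed
  have "real (card {M \<in> ncm S. {k, l} \<in> M}) =
      real (card (ncm (S \<inter> {k<..<l}))) * real (card (ncm (S - {k..l})))"
    using card_ncm_split[OF kl, of "{}" "{}"] by simp
  also have "\<dots> = catalan m"
    using side
  proof
    assume e: "S \<inter> {k<..<l} = {}"
    then have "card (S - {k..l}) = 2 * m" using part c by simp
    then show ?thesis using e S card_ncm[of "S - {k..l}" m] by (simp add: ncm_empty)
  next
    assume e: "S - {k..l} = {}"
    have "card (S - {k..l}) = 0" unfolding e by simp
    then have "card (S \<inter> {k<..<l}) = 2 * m" using part c by simp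
    then show ?thesis unfolding e using S card_ncm[of "S \<inter> {k<..<l}" m] by (simp add: ncm_empty)
  qed
  finally show ?thesis .
qed

text \<open>The first chord has \<open>n - 2\<close> labels strictly inside and \<open>n\<close>
  outside. The parallel chord uses two of the latter and does not separate the others, so both gaps
  have \<open>n - 2\<close> labels.\<close>

lemma card_matchings_parallel_chords:
  assumes "even n" "2 \<le> n" and a: "a < n"
  shows "real (card {M \<in> matchings n. {a, a + n - 1} \<in> M \<and> parallel_chord n a \<in> M}) =
    (catalan ((n - 2) div 2))\<^sup>2"
proof -
  define S where "S = {..<2 * n}"
  define m where "m = (n - 2) div 2"
  have m: "n = 2 * m + 2" using assms by (auto simp: m_def)
  have S: "a < a + n - 1" "a \<in> S" "a + n - 1 \<in> S" using assms by (auto simp: S_def)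
  \<comment> \<open>For \<open>a = 0\<close> all other labels outside the first chord lie between
    \<open>k\<close> and \<open>l\<close>; for \<open>a > 0\<close> none of them does.\<close>
  obtain k l where kl: "k < l" "l < 2 * n" "parallel_chord n a = {k, l}"
      "k \<in> S - {a..a + n - 1}" "l \<in> S - {a..a + n - 1}"
      "(S - {a..a + n - 1}) \<inter> {k<..<l} = {} \<or> (S - {a..a + n - 1}) - {k..l} = {}"
  proof (cases "a = 0")
    case True
    have "(S - {a..a + n - 1}) - {n..2 * n - 1} = {}" using True by (auto simp: S_def)
    then show thesis using that[of n "2 * n - 1"] True assms by (auto simp: parallel_chord_def S_def)
  next
    case False
    have "{a - 1<..<a + n} = {a..a + n - 1}" using False assms by auto
    then have "(S - {a..a + n - 1}) \<inter> {a - 1<..<a + n} = {}" by auto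
    then show thesis using that[of "a - 1" "a + n"] False assms by (auto simp: parallel_chord_def S_def)
  qed
  have eq: "{M \<in> matchings n. {a, a + n - 1} \<in> M \<and> parallel_chord n a \<in> M} =
      {M \<in> ncm S. {a, a + n - 1} \<in> M \<and> {} \<subseteq> M \<and> {{k, l}} \<subseteq> M}"
    by (simp add: matchings_eq_ncm kl(3) S_def)
  have "card {M \<in> ncm S. {a, a + n - 1} \<in> M \<and> {} \<subseteq> M \<and> {{k, l}} \<subseteq> M} =
      card {A \<in> ncm (S \<inter> {a<..<a + n - 1}). {} \<subseteq> A} *
      card {B \<in> ncm (S - {a..a + n - 1}). {{k, l}} \<subseteq> B}"
    using kl by (intro card_ncm_split[OF S]) auto
  then have "real (card {M \<in> matchings n. {a, a + n - 1} \<in> M \<and> parallel_chord n a \<in> M}) =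
      real (card (ncm (S \<inter> {a<..<a + n - 1}))) * real (card {B \<in> ncm (S - {a..a + n - 1}). {k, l} \<in> B})"
    unfolding eq by simp
  also have "real (card (ncm (S \<inter> {a<..<a + n - 1}))) = catalan m"
  proof (rule card_ncm)
    have "S \<inter> {a<..<a + n - 1} = {a<..<a + n - 1}" using a by (auto simp: S_def)
    then show "card (S \<inter> {a<..<a + n - 1}) = 2 * m" using m by simp
  qed (simp add: S_def)
  also have "real (card {B \<in> ncm (S - {a..a + n - 1}). {k, l} \<in> B}) = catalan m"
  proof (rule card_ncm_containing_chord[OF _ kl(1,4,5) _ kl(6)])
    have "card (S - {a..a + n - 1}) = 2 * n - n"
      unfolding S_def using a assms by (subst card_Diff_subset) auto
    then show "card (S - {a..a + n - 1}) = 2 * m + 2" using m by simp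
  qed (simp add: S_def)
  finally show ?thesis by (simp add: m_def power2_eq_square)
qed

text \<open>On each side of the diameter the chord of the extreme labels uses two of the
  \<open>n - 1\<close> labels, leaving a gap of \<open>n - 3\<close>.\<close>

lemma card_matchings_diameter:
  assumes "odd n" "3 \<le> n" and p: "p < n"
  shows "real (card {M \<in> matchings n. {p, p + n} \<in> M \<and> {p + 1, p + n - 1} \<in> M \<and> far_chord n p \<in> M}) =
    (catalan ((n - 3) div 2))\<^sup>2"
proof -
  define S where "S = {..<2 * n}"
  define m where "m = (n - 3) div 2"
  have m: "n = 2 * m + 3" using assms by (auto simp: m_def elim!: oddE)
  have S: "p < p + n" "p \<in> S" "p + n \<in> S" using assms by (auto simp: S_def)
  obtain k l where kl: "k < l" "far_chord n p = {k, l}"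
    using card_2_ordered[OF cap_far_chord(4)[OF p assms(2)]] .
  have klS: "k \<in> S - {p..p + n}" "l \<in> S - {p..p + n}" using cap_far_chord(3)[OF p assms(2)] kl by (auto simp: S_def)
  have side: "(S - {p..p + n}) \<inter> {k<..<l} = {} \<or> (S - {p..p + n}) - {k..l} = {}"
  proof -
    have "cap n {k, l} = S - {p..p + n}" using cap_far_chord(1)[OF p assms(2)] kl(2) by (simp add: S_def)
    moreover have "cap n {k, l} \<inter> {k<..<l} = {} \<or> cap n {k, l} - {k..l} = {}"
      using kl(1) by (auto simp: cap_def between_insert)
    ultimately show ?thesis by simp
  qed
  have in': "S \<inter> {p<..<p + n} = {p<..<p + n}" using p by (auto simp: S_def)
  have eq: "{M \<in> matchings n. {p, p + n} \<in> M \<and> {p + 1, p + n - 1} \<in> M \<and> far_chord n p \<in> M} =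
      {M \<in> ncm S. {p, p + n} \<in> M \<and> {{p + 1, p + n - 1}} \<subseteq> M \<and> {{k, l}} \<subseteq> M}"
    by (simp add: matchings_eq_ncm kl(2) S_def)
  have "card {M \<in> ncm S. {p, p + n} \<in> M \<and> {{p + 1, p + n - 1}} \<subseteq> M \<and> {{k, l}} \<subseteq> M} =
      card {A \<in> ncm (S \<inter> {p<..<p + n}). {{p + 1, p + n - 1}} \<subseteq> A} *
      card {B \<in> ncm (S - {p..p + n}). {{k, l}} \<subseteq> B}"
    using klS assms by (intro card_ncm_split[OF S]) (auto simp: in')
  then have "real (card {M \<in> matchings n. {p, p + n} \<in> M \<and> {p + 1, p + n - 1} \<in> M \<and> far_chord n p \<in> M}) =
      real (card {A \<in> ncm {p<..<p + n}. {p + 1, p + n - 1} \<in> A}) *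
      real (card {B \<in> ncm (S - {p..p + n}). {k, l} \<in> B})"
    unfolding eq by (simp add: in')
  also have "real (card {A \<in> ncm {p<..<p + n}. {p + 1, p + n - 1} \<in> A}) = catalan m"
    using assms m by (intro card_ncm_containing_chord) auto
  also have "real (card {B \<in> ncm (S - {p..p + n}). {k, l} \<in> B}) = catalan m"
  proof (rule card_ncm_containing_chord[OF _ kl(1) klS _ side])
    have "card (S - {p..p + n}) = 2 * n - (n + 1)"
      unfolding S_def using p assms by (subst card_Diff_subset) auto
    then show "card (S - {p..p + n}) = 2 * m + 2" using m by simp
  qed (simp add: S_def)
  finally show ?thesis by (simp add: m_def power2_eq_square)
qed

section \<open>Minimum degrees and the number of matchings attaining them\<close>

lemma H_degree_even:
  assumes "M \<in> matchings n" "even n" "2 \<le> n"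
  shows "1 \<le> H_degree n M"
    and "H_degree n M = 1 \<longleftrightarrow> (\<exists>a<n. {a, a + n - 1} \<in> M \<and> parallel_chord n a \<in> M)"
  using centered_pairs_even[OF assms] H_degree_eq_card_centered_pairs[OF assms(1)] by simp_all

lemma H_degree_odd:
  assumes M: "M \<in> matchings n" and n: "odd n" "3 \<le> n"
  shows "2 \<le> H_degree n M"
    and "H_degree n M = 2 \<longleftrightarrow>
      (\<exists>p<n. {p, p + n} \<in> M \<and> {p + 1, p + n - 1} \<in> M \<and> far_chord n p \<in> M)"
proof -
  note deg = H_degree_eq_card_centered_pairs[OF M]
  have "2 \<le> H_degree n M \<and> (H_degree n M = 2 \<longleftrightarrow>
      (\<exists>p<n. {p, p + n} \<in> M \<and> {p + 1, p + n - 1} \<in> M \<and> far_chord n p \<in> M))"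
  proof (cases "\<exists>d\<in>M. diametral n d")
    case True
    then obtain d where d: "d \<in> M" "diametral n d" by blast
    then obtain p where p: "p < n" "d = {p, p + n}" using diameter_edge[OF M] by metis
    have dp: "{p, p + n} \<in> M" using d p by simp
    have "q = p" if "q < n" "{q, q + n} \<in> M" for q
    \<comment> \<open>The diameter is unique, so the existential quantifier over its first label
      collapses to the given \<open>p\<close>.\<close>
    proof -
      have "{q, q + n} = {p, p + n}"
        using diameter_unique[OF M that(2) _ d] that(1) p by (simp add: diametral_insert)
      then show ?thesis using n by (auto simp: doubleton_eq_iff)
    qed
    then have "(\<exists>p<n. {p, p + n} \<in> M \<and> {p + 1, p + n - 1} \<in> M \<and> far_chord n p \<in> M) \<longleftrightarrow>
        {p + 1, p + n - 1} \<in> M \<and> far_chord n p \<in> M" using p(1) dp by blast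
    then show ?thesis using centered_pairs_odd_diameter[OF M dp n(2)] deg by simp
  next
    case False
    then have "\<not> (\<exists>p<n. {p, p + n} \<in> M)" using n by (auto simp: diametral_insert)
    moreover have "3 \<le> H_degree n M"
      using centered_pairs_odd_no_diameter[OF M n(1)] False deg by simp
    ultimately show ?thesis by auto
  qed
  then show "2 \<le> H_degree n M" "H_degree n M = 2 \<longleftrightarrow>
      (\<exists>p<n. {p, p + n} \<in> M \<and> {p + 1, p + n - 1} \<in> M \<and> far_chord n p \<in> M)" by blast+
qed

lemma H_min_degree_eqI:
  assumes "\<And>M. M \<in> matchings n \<Longrightarrow> c \<le> H_degree n M" "{M \<in> matchings n. H_degree n M = c} \<noteq> {}"
  shows "H_min_degree n = c"
  unfolding H_min_degree_def using assms finite_matchings by (intro Min_eqI) auto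

lemma catalan_pos: "0 < catalan m"
  by (simp add: catalan_def)

lemma card_degree_one_even:
  assumes n: "even n" "2 \<le> n"
  shows "real (card {M \<in> matchings n. H_degree n M = 1}) = real n * (catalan ((n - 2) div 2))\<^sup>2"
proof -
  define A where "A a = {M \<in> matchings n. {a, a + n - 1} \<in> M \<and> parallel_chord n a \<in> M}" for a
  have "{M \<in> matchings n. H_degree n M = 1} = (\<Union>a\<in>{..<n}. A a)"
    using H_degree_even(2)[OF _ n] by (auto simp: A_def)
  also have "card \<dots> = (\<Sum>a<n. card (A a))"
  proof (rule card_UN_disjoint)
    show "\<forall>a\<in>{..<n}. finite (A a)" using finite_matchings by (simp add: A_def)
    \<comment> \<open>From \<open>a < b < n\<close> follows
      \<open>b \<le> a + n - 1 < b + n - 1\<close>, so the two chords would cross or share an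
      endpoint. Restricting the index to labels below \<open>n\<close> therefore counts each
      matching once.\<close>
    have disj: "A a \<inter> A b = {}" if ab: "a < b" "b < n" for a b
    proof (rule ccontr)
      assume "A a \<inter> A b \<noteq> {}"
      then obtain M where M: "M \<in> matchings n" "{a, a + n - 1} \<in> M" "{b, b + n - 1} \<in> M"
        unfolding A_def by blast
      have "{a, a + n - 1} \<noteq> {b, b + n - 1}" using ab n by (auto simp: doubleton_eq_iff)
      then obtain i j k l where "i < j" "j < 2 * n" "{a, a + n - 1} = {i, j}" "k < l" "l < 2 * n"
        "{b, b + n - 1} = {k, l}" "j < k \<or> l < i \<or> i < k \<and> l < j \<or> k < i \<and> j < l"
        using matchings_edge_pair[OF M] by metis
      moreover then have "i = a" "j = a + n - 1" "k = b" "l = b + n - 1"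
        using n by (auto simp: doubleton_eq_iff)
      ultimately show False using ab by linarith
    qed
    show "\<forall>a\<in>{..<n}. \<forall>b\<in>{..<n}. a \<noteq> b \<longrightarrow> A a \<inter> A b = {}"
      using disj by (metis Int_commute lessThan_iff linorder_neqE_nat)
  qed simp
  finally have "real (card {M \<in> matchings n. H_degree n M = 1}) = (\<Sum>a<n. real (card (A a)))" by simp
  also have "\<dots> = (\<Sum>a<n. (catalan ((n - 2) div 2))\<^sup>2)"
    using card_matchings_parallel_chords[OF n] by (intro sum.cong) (auto simp: A_def)
  finally show ?thesis by simp
qed

lemma card_degree_two_odd:
  assumes n: "odd n" "3 \<le> n"
  shows "real (card {M \<in> matchings n. H_degree n M = 2}) = real n * (catalan ((n - 3) div 2))\<^sup>2"
proof -
  define A where "A p = {M \<in> matchings n. {p, p + n} \<in> M \<and> {p + 1, p + n - 1} \<in> M \<and> far_chord n p \<in> M}" for p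
  have "{M \<in> matchings n. H_degree n M = 2} = (\<Union>p\<in>{..<n}. A p)"
    using H_degree_odd(2)[OF _ n] by (auto simp: A_def)
  also have "card \<dots> = (\<Sum>p<n. card (A p))"
  proof (rule card_UN_disjoint)
    show "\<forall>p\<in>{..<n}. finite (A p)" using finite_matchings by (simp add: A_def)
    \<comment> \<open>The unique diameter of a matching determines the index.\<close>
    show "\<forall>p\<in>{..<n}. \<forall>q\<in>{..<n}. p \<noteq> q \<longrightarrow> A p \<inter> A q = {}"
    proof (intro ballI impI, rule ccontr)
      fix p q assume pq: "p \<in> {..<n}" "q \<in> {..<n}" "p \<noteq> q" "A p \<inter> A q \<noteq> {}"
      then obtain M where M: "M \<in> matchings n" "{p, p + n} \<in> M" "{q, q + n} \<in> M"
        unfolding A_def by blast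
      have "{p, p + n} = {q, q + n}"
        using diameter_unique[OF M(1,2) _ M(3)] n by (simp add: diametral_insert)
      then show False using pq(3) n by (auto simp: doubleton_eq_iff)
    qed
  qed simp
  finally have "real (card {M \<in> matchings n. H_degree n M = 2}) = (\<Sum>p<n. real (card (A p)))" by simp
  also have "\<dots> = (\<Sum>p<n. (catalan ((n - 3) div 2))\<^sup>2)"
    using card_matchings_diameter[OF n] by (intro sum.cong) (auto simp: A_def)
  finally show ?thesis by simp
qed

lemma odd_degree_two_characterization:
  assumes M: "M \<in> matchings n" and n: "odd n" "3 \<le> n"
  shows "H_degree n M = 2 \<longleftrightarrow>
    card {e \<in> M. edge_length n M e = mu n \<and> 0 \<in> pt_hull n e} = 1 \<and>
    card {e \<in> M. edge_length n M e = mu n - 1} = 2"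
proof (cases "\<exists>d\<in>M. diametral n d")
  case True
  then obtain d where d: "d \<in> M" "diametral n d" by blast
  then obtain p where p: "p < n" "d = {p, p + n}" using diameter_edge[OF M] by metis
  have dp: "{p, p + n} \<in> M" using d p by simp
  have "{e \<in> M. diametral n e} = {d}" using d diameter_unique[OF M d] by blast
  then have "card {e \<in> M. edge_length n M e = mu n \<and> 0 \<in> pt_hull n e} = 1"
    by (simp add: diameters_odd_eq[OF M n])
  then show ?thesis
    using two_second_longest_edges_odd_iff[OF M n dp] centered_pairs_odd_diameter(2)[OF M dp n(2)]
      H_degree_eq_card_centered_pairs[OF M] by simp
next
  case False
  then have "{e \<in> M. diametral n e} = {}" by blast
  then have "card {e \<in> M. diametral n e} = 0" by (simp only: card.empty)
  moreover have "H_degree n M \<noteq> 2"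
    using centered_pairs_odd_no_diameter[OF M n(1)] False H_degree_eq_card_centered_pairs[OF M] by auto
  ultimately show ?thesis unfolding diameters_odd_eq[OF M n] by simp
qed

theorem theorem5:
  fixes n :: nat
  shows "(odd n \<and> n \<ge> 3 \<longrightarrow>
           H_min_degree n = 2 \<and>
           real (card {M \<in> matchings n. H_degree n M = 2}) = real n * (catalan ((n - 3) div 2))\<^sup>2 \<and>
           {M \<in> matchings n. H_degree n M = 2} =
             {M \<in> matchings n.
                card {e \<in> M. edge_length n M e = mu n \<and> 0 \<in> pt_hull n e} = 1 \<and>
                card {e \<in> M. edge_length n M e = mu n - 1} = 2}) \<and>
         (even n \<and> n \<ge> 2 \<longrightarrow>
           H_min_degree n = 1 \<and>
           real (card {M \<in> matchings n. H_degree n M = 1}) = real n * (catalan ((n - 2) div 2))\<^sup>2 \<and>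
           {M \<in> matchings n. H_degree n M = 1} =
             {M \<in> matchings n. card {e \<in> M. edge_length n M e = mu n} = 2})"
proof (intro conjI impI; elim conjE)
  assume n: "odd n" "3 \<le> n"
  show count: "real (card {M \<in> matchings n. H_degree n M = 2}) = real n * (catalan ((n - 3) div 2))\<^sup>2"
    by (rule card_degree_two_odd[OF n])
  \<comment> \<open>Positivity of the count provides a matching at which the lower bound for the
    degree is attained.\<close>
  have "0 < real n * (catalan ((n - 3) div 2))\<^sup>2" using n by (intro mult_pos_pos zero_less_power catalan_pos) auto
  then have "{M \<in> matchings n. H_degree n M = 2} \<noteq> {}" unfolding count[symmetric]
    by (metis card.empty less_irrefl of_nat_0)
  then show "H_min_degree n = 2" using H_degree_odd(1)[OF _ n] by (intro H_min_degree_eqI)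
  show "{M \<in> matchings n. H_degree n M = 2} = {M \<in> matchings n.
      card {e \<in> M. edge_length n M e = mu n \<and> 0 \<in> pt_hull n e} = 1 \<and>
      card {e \<in> M. edge_length n M e = mu n - 1} = 2}"
    using odd_degree_two_characterization[OF _ n] by (intro Collect_cong conj_cong refl)
next
  assume n: "even n" "2 \<le> n"
  show count: "real (card {M \<in> matchings n. H_degree n M = 1}) = real n * (catalan ((n - 2) div 2))\<^sup>2"
    by (rule card_degree_one_even[OF n])
  have "0 < real n * (catalan ((n - 2) div 2))\<^sup>2" using n by (intro mult_pos_pos zero_less_power catalan_pos) auto
  then have "{M \<in> matchings n. H_degree n M = 1} \<noteq> {}" unfolding count[symmetric]
    by (metis card.empty less_irrefl of_nat_0)
  then show "H_min_degree n = 1" using H_degree_even(1)[OF _ n] by (intro H_min_degree_eqI)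
  show "{M \<in> matchings n. H_degree n M = 1} = {M \<in> matchings n. card {e \<in> M. edge_length n M e = mu n} = 2}"
    using H_degree_even(2)[OF _ n] two_longest_edges_even_iff[OF _ n]
    by (intro Collect_cong conj_cong refl) simp
qed

end
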